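(* Let $G$ be a connected, simply connected, non-abelian nilpotent Lie group of dimension $5$ with Lie algebra $\mathfrak g$, and let $\Gamma\backslash G$ be a nilmanifold, with $\Gamma\subset G$ a discrete subgroup. If $\Gamma\backslash G$ admits a nonzero left-invariant harmonic spinor for some left-invariant Riemannian metric, then $\mathfrak g$ is isomorphic to one of $L_{5,1},L_{5,2},L_{5,3},L_{5,4},L_{5,6}$.
   Context: Lie algebras are given by the differentials $(de^1,\dots,de^5)$ of a basis of $\mathfrak g^*$, where $ij$ stands for $e^i\wedge e^j$ and $de^k(X,Y)=-e^k([X,Y])$: $L_{5,1}=(0,0,0,0,12+34)$, $L_{5,2}=(0,0,0,12,13)$, $L_{5,3}=(0,0,0,12,14+23)$, $L_{5,4}=(0,0,12,13,14)$, $L_{5,6}=(0,0,12,13,14+23)$. (The remaining non-abelian 5-dimensional nilpotent Lie algebras are $(0,0,0,0,12)$, $(0,0,0,12,14)$ and $L_{5,5}=(0,0,12,13,23)$.) Clifford convention: $v\cdot v=-|v|^2$. For a left-invariant metric $g$ with left-invariant orthonormal frame $(e_1,\dots,e_n)$, fix an irreducible real representation $\rho:\mathrm{Cl}_n\to\mathrm{End}(W)$. With the trivial spin structure on $\Gamma\backslash G$ (the quotient of $G\times\mathrm{Spin}(n)$ by $y\cdot(x,\tilde h)=(yx,\tilde h)$), spinors are $\Gamma$-invariant maps $\phi:G\to W$; left-invariant spinors are the constant ones. The Dirac operator is $D\phi=\sum_ie_i\nabla_{e_i}\phi$ with $\nabla_X\phi=d_X\phi+\frac12\sum_{j<k}g(\overline\nabla_Xe_j,e_k)e_je_k\phi$,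 $\overline\nabla$ the Levi-Civita connection. A spinor is harmonic if $D\phi=0$. *)

theory Defs
  imports "HOL-Analysis.Analysis" "HOL-Library.Function_Algebras" "HOL-Algebra.Group"
begin

section \<open>Pointwise real vector space structure on function spaces\<close>

instantiation "fun" :: (type, real_vector) real_vector
begin

definition scaleR_fun :: "real \<Rightarrow> ('a \<Rightarrow> 'b) \<Rightarrow> 'a \<Rightarrow> 'b"
  where "scaleR_fun c f = (\<lambda>x. c *\<^sub>R f x)"

instance
  by standard (simp_all add: scaleR_fun_def fun_eq_iff scaleR_add_left scaleR_add_right)

end

section \<open>Smooth manifolds and Lie groups\<close>

text \<open>\<open>C\<close>-\<open>k\<close> and smooth functions; both are meant for open \<open>S\<close> only.\<close>

primrec Ck_on :: "nat \<Rightarrow> ('a::euclidean_space \<Rightarrow> 'b::real_normed_vector) \<Rightarrow> 'a set \<Rightarrow> bool" where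
  "Ck_on 0 f S \<longleftrightarrow> continuous_on S f"
| "Ck_on (Suc k) f S \<longleftrightarrow>
     f differentiable_on S \<and> (\<forall>b\<in>Basis. Ck_on k (\<lambda>x. frechet_derivative f (at x) b) S)"

definition smooth_on :: "('a::euclidean_space \<Rightarrow> 'b::real_normed_vector) \<Rightarrow> 'a set \<Rightarrow> bool"
  where "smooth_on f S \<longleftrightarrow> (\<forall>k. Ck_on k f S)"

text \<open>An atlas is a set of pairs (domain, chart map). The manifold is the whole type \<open>'g\<close>, whose
  sort provides the Hausdorff property and second countability.\<close>

type_synonym ('g, 'n) atlas = "('g set \<times> ('g \<Rightarrow> real ^ 'n)) set"

definition smooth_atlas ::
  "('g::{t2_space, second_countable_topology}, 'n::finite) atlas \<Rightarrow> bool" where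
  "smooth_atlas \<A> \<longleftrightarrow>
     (\<Union>(U, \<psi>)\<in>\<A>. U) = UNIV \<and>
     (\<forall>(U, \<psi>)\<in>\<A>. open U \<and> open (\<psi> ` U) \<and> homeomorphism U (\<psi> ` U) \<psi> (inv_into U \<psi>)) \<and>
     (\<forall>(U, \<psi>)\<in>\<A>. \<forall>(V, \<xi>)\<in>\<A>. smooth_on (\<xi> \<circ> inv_into U \<psi>) (\<psi> ` (U \<inter> V)))"

definition smooth_functions ::
  "('g::{t2_space, second_countable_topology}, 'n::finite) atlas \<Rightarrow> ('g \<Rightarrow> real) set" where
  "smooth_functions \<A> = {f. \<forall>(U, \<psi>)\<in>\<A>. smooth_on (f \<circ> inv_into U \<psi>) (\<psi> ` U)}"

definition lie_group ::
  "('g::{t2_space, second_countable_topology}, 'n::finite) atlas \<Rightarrow> 'g monoid \<Rightarrow> bool" where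
  "lie_group \<A> G \<longleftrightarrow>
     smooth_atlas \<A> \<and> group G \<and> carrier G = UNIV \<and>
     continuous_on UNIV (\<lambda>(x, y). x \<otimes>\<^bsub>G\<^esub> y) \<and>
     (\<forall>(U, \<psi>)\<in>\<A>. \<forall>(V, \<xi>)\<in>\<A>. \<forall>(W, \<omega>)\<in>\<A>.
        smooth_on (\<lambda>(u, v). \<omega> (inv_into U \<psi> u \<otimes>\<^bsub>G\<^esub> inv_into V \<xi> v))
          {(\<psi> x, \<xi> y) | x y. x \<in> U \<and> y \<in> V \<and> x \<otimes>\<^bsub>G\<^esub> y \<in> W}) \<and>
     continuous_on UNIV (\<lambda>x. inv\<^bsub>G\<^esub> x) \<and>
     (\<forall>(U, \<psi>)\<in>\<A>. \<forall>(V, \<xi>)\<in>\<A>.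
        smooth_on (\<lambda>u. \<xi> (inv\<^bsub>G\<^esub> (inv_into U \<psi> u))) {\<psi> x | x. x \<in> U \<and> inv\<^bsub>G\<^esub> x \<in> V})"

section \<open>Vector fields and the Lie algebra\<close>

text \<open>Vector fields are derivations of the algebra of smooth functions. They are set to 0 on
  non-smooth functions, so that two vector fields are equal iff they agree as derivations. Sums,
  products and real multiples of functions and of vector fields are the pointwise ones.\<close>

type_synonym 'g vfield = "('g \<Rightarrow> real) \<Rightarrow> 'g \<Rightarrow> real"

definition vector_fields ::
  "('g::{t2_space, second_countable_topology}, 'n::finite) atlas \<Rightarrow> 'g vfield set" where
  "vector_fields \<A> = {X.
     (\<forall>f\<in>smooth_functions \<A>. X f \<in> smooth_functions \<A>) \<and>
     (\<forall>f\<in>smooth_functions \<A>. \<forall>h\<in>smooth_functions \<A>. X (f + h) = X f + X h) \<and>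
     (\<forall>f\<in>smooth_functions \<A>. \<forall>c::real. X (c *\<^sub>R f) = c *\<^sub>R X f) \<and>
     (\<forall>f\<in>smooth_functions \<A>. \<forall>h\<in>smooth_functions \<A>. X (f * h) = f * X h + h * X f) \<and>
     (\<forall>f. f \<notin> smooth_functions \<A> \<longrightarrow> X f = 0)}"

definition vf_mult :: "('g \<Rightarrow> real) \<Rightarrow> 'g vfield \<Rightarrow> 'g vfield"
  where "vf_mult f X = (\<lambda>h. f * X h)"

definition vf_bracket :: "'g vfield \<Rightarrow> 'g vfield \<Rightarrow> 'g vfield"
  where "vf_bracket X Y = (\<lambda>f. X (Y f) - Y (X f))"

text \<open>The Lie algebra of \<open>G\<close>: left-invariant vector fields, with the commutator as bracket.\<close>

definition lie_algebra_of ::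
  "('g::{t2_space, second_countable_topology}, 'n::finite) atlas \<Rightarrow> 'g monoid \<Rightarrow> 'g vfield set" where
  "lie_algebra_of \<A> G = {X \<in> vector_fields \<A>.
     \<forall>a. \<forall>f\<in>smooth_functions \<A>. X (\<lambda>x. f (a \<otimes>\<^bsub>G\<^esub> x)) = (\<lambda>x. X f (a \<otimes>\<^bsub>G\<^esub> x))}"

definition abelian_lie :: "'l::real_vector set \<Rightarrow> ('l \<Rightarrow> 'l \<Rightarrow> 'l) \<Rightarrow> bool"
  where "abelian_lie L br \<longleftrightarrow> (\<forall>X\<in>L. \<forall>Y\<in>L. br X Y = 0)"

primrec lower_central ::
  "'l::real_vector set \<Rightarrow> ('l \<Rightarrow> 'l \<Rightarrow> 'l) \<Rightarrow> nat \<Rightarrow> 'l set" where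
  "lower_central L br 0 = L"
| "lower_central L br (Suc k) = span {br X Y | X Y. X \<in> L \<and> Y \<in> lower_central L br k}"

definition nilpotent_lie :: "'l::real_vector set \<Rightarrow> ('l \<Rightarrow> 'l \<Rightarrow> 'l) \<Rightarrow> bool"
  where "nilpotent_lie L br \<longleftrightarrow> (\<exists>k. lower_central L br k = {0})"

definition lie_isomorphic ::
  "'l::real_vector set \<Rightarrow> ('l \<Rightarrow> 'l \<Rightarrow> 'l) \<Rightarrow> 'm::real_vector set \<Rightarrow> ('m \<Rightarrow> 'm \<Rightarrow> 'm) \<Rightarrow> bool" where
  "lie_isomorphic L br M br' \<longleftrightarrow> (\<exists>F. bij_betw F L M \<and>
     (\<forall>X\<in>L. \<forall>Y\<in>L. F (X + Y) = F X + F Y) \<and>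
     (\<forall>X\<in>L. \<forall>c::real. F (c *\<^sub>R X) = c *\<^sub>R F X) \<and>
     (\<forall>X\<in>L. \<forall>Y\<in>L. F (br X Y) = br' (F X) (F Y)))"

text \<open>For connected Lie groups we follow the convention that nilpotency and commutativity refer to
  the Lie algebra.\<close>

definition nilpotent_lie_group ::
  "('g::{t2_space, second_countable_topology}, 'n::finite) atlas \<Rightarrow> 'g monoid \<Rightarrow> bool" where
  "nilpotent_lie_group \<A> G \<longleftrightarrow> lie_group \<A> G \<and> nilpotent_lie (lie_algebra_of \<A> G) vf_bracket"

definition abelian_lie_group ::
  "('g::{t2_space, second_countable_topology}, 'n::finite) atlas \<Rightarrow> 'g monoid \<Rightarrow> bool" where
  "abelian_lie_group \<A> G \<longleftrightarrow> lie_group \<A> G \<and> abelian_lie (lie_algebra_of \<A> G) vf_bracket"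

section \<open>The Lie algebras given by differentials\<close>

text \<open>\<open>wedge i j\<close> is the 2-form \<open>e\<^sup>i \<and> e\<^sup>j\<close> on \<open>real ^ 5\<close>. In the index type \<open>5\<close> the numeral 5 is the
  element 0, so 1, ..., 5 are five distinct indices.\<close>

definition wedge :: "5 \<Rightarrow> 5 \<Rightarrow> real ^ 5 \<Rightarrow> real ^ 5 \<Rightarrow> real"
  where "wedge i j X Y = X $ i * Y $ j - X $ j * Y $ i"

text \<open>The bracket with \<open>e\<^sup>k [X, Y] = - de\<^sup>k (X, Y)\<close>, where \<open>de\<close> lists the differentials of the dual
  standard basis.\<close>

definition bracket_of_diffs ::
  "(real ^ 5 \<Rightarrow> real ^ 5 \<Rightarrow> real) ^ 5 \<Rightarrow> real ^ 5 \<Rightarrow> real ^ 5 \<Rightarrow> real ^ 5"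
  where "bracket_of_diffs de X Y = (\<chi> k. - (de $ k) X Y)"

definition L51 :: "real ^ 5 \<Rightarrow> real ^ 5 \<Rightarrow> real ^ 5"
  where "L51 = bracket_of_diffs (vector [0, 0, 0, 0, wedge 1 2 + wedge 3 4])"

definition L52 :: "real ^ 5 \<Rightarrow> real ^ 5 \<Rightarrow> real ^ 5"
  where "L52 = bracket_of_diffs (vector [0, 0, 0, wedge 1 2, wedge 1 3])"

definition L53 :: "real ^ 5 \<Rightarrow> real ^ 5 \<Rightarrow> real ^ 5"
  where "L53 = bracket_of_diffs (vector [0, 0, 0, wedge 1 2, wedge 1 4 + wedge 2 3])"

definition L54 :: "real ^ 5 \<Rightarrow> real ^ 5 \<Rightarrow> real ^ 5"
  where "L54 = bracket_of_diffs (vector [0, 0, wedge 1 2, wedge 1 3, wedge 1 4])"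

definition L56 :: "real ^ 5 \<Rightarrow> real ^ 5 \<Rightarrow> real ^ 5"
  where "L56 = bracket_of_diffs (vector [0, 0, wedge 1 2, wedge 1 3, wedge 1 4 + wedge 2 3])"

section \<open>Left-invariant Riemannian metrics, Levi-Civita connection, frames\<close>

text \<open>A Riemannian metric as a symmetric, positive definite form on vector fields that is bilinear
  over the smooth functions. The tangent vector of \<open>X\<close> at \<open>p\<close> is nonzero iff \<open>X f p \<noteq> 0\<close> for some
  smooth \<open>f\<close>.\<close>

type_synonym 'g metric_tensor = "'g vfield \<Rightarrow> 'g vfield \<Rightarrow> 'g \<Rightarrow> real"

definition riemannian_metric ::
  "('g::{t2_space, second_countable_topology}, 'n::finite) atlas \<Rightarrow> 'g metric_tensor \<Rightarrow> bool" where
  "riemannian_metric \<A> g \<longleftrightarrow>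
     (\<forall>X\<in>vector_fields \<A>. \<forall>Y\<in>vector_fields \<A>. g X Y \<in> smooth_functions \<A> \<and> g X Y = g Y X) \<and>
     (\<forall>X\<in>vector_fields \<A>. \<forall>Y\<in>vector_fields \<A>. \<forall>Z\<in>vector_fields \<A>. g (X + Y) Z = g X Z + g Y Z) \<and>
     (\<forall>f\<in>smooth_functions \<A>. \<forall>X\<in>vector_fields \<A>. \<forall>Y\<in>vector_fields \<A>.
        g (vf_mult f X) Y = f * g X Y) \<and>
     (\<forall>X\<in>vector_fields \<A>. \<forall>p. (\<exists>f\<in>smooth_functions \<A>. X f p \<noteq> 0) \<longrightarrow> g X X p > 0)"

text \<open>Pushforward of a vector field under the left translation by \<open>a\<close>.\<close>

definition left_push ::
  "('g::{t2_space, second_countable_topology}, 'n::finite) atlas \<Rightarrow> 'g monoid \<Rightarrow> 'g \<Rightarrow>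
     'g vfield \<Rightarrow> 'g vfield" where
  "left_push \<A> G a X = (\<lambda>f. if f \<in> smooth_functions \<A>
     then (\<lambda>x. X (\<lambda>y. f (a \<otimes>\<^bsub>G\<^esub> y)) (inv\<^bsub>G\<^esub> a \<otimes>\<^bsub>G\<^esub> x)) else 0)"

definition left_invariant_metric ::
  "('g::{t2_space, second_countable_topology}, 'n::finite) atlas \<Rightarrow> 'g monoid \<Rightarrow>
     'g metric_tensor \<Rightarrow> bool" where
  "left_invariant_metric \<A> G g \<longleftrightarrow> riemannian_metric \<A> g \<and>
     (\<forall>a x. \<forall>X\<in>vector_fields \<A>. \<forall>Y\<in>vector_fields \<A>.
        g (left_push \<A> G a X) (left_push \<A> G a Y) (a \<otimes>\<^bsub>G\<^esub> x) = g X Y x)"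

definition levi_civita ::
  "('g::{t2_space, second_countable_topology}, 'n::finite) atlas \<Rightarrow> 'g metric_tensor \<Rightarrow>
     ('g vfield \<Rightarrow> 'g vfield \<Rightarrow> 'g vfield) \<Rightarrow> bool" where
  "levi_civita \<A> g con \<longleftrightarrow>
     (\<forall>X\<in>vector_fields \<A>. \<forall>Y\<in>vector_fields \<A>. con X Y \<in> vector_fields \<A>) \<and>
     (\<forall>X\<in>vector_fields \<A>. \<forall>Y\<in>vector_fields \<A>. \<forall>Z\<in>vector_fields \<A>.
        con (X + Y) Z = con X Z + con Y Z \<and> con X (Y + Z) = con X Y + con X Z) \<and>
     (\<forall>f\<in>smooth_functions \<A>. \<forall>X\<in>vector_fields \<A>. \<forall>Y\<in>vector_fields \<A>.
        con (vf_mult f X) Y = vf_mult f (con X Y) \<and>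
        con X (vf_mult f Y) = vf_mult (X f) Y + vf_mult f (con X Y)) \<and>
     (\<forall>X\<in>vector_fields \<A>. \<forall>Y\<in>vector_fields \<A>. \<forall>Z\<in>vector_fields \<A>.
        X (g Y Z) = g (con X Y) Z + g Y (con X Z)) \<and>
     (\<forall>X\<in>vector_fields \<A>. \<forall>Y\<in>vector_fields \<A>. con X Y - con Y X = vf_bracket X Y)"

text \<open>Orthonormality gives linear independence at each point; the last clause says that
  \<open>e 1, ..., e n\<close> generate the module of vector fields, i.e. span every tangent space.\<close>

definition left_invariant_orthonormal_frame ::
  "('g::{t2_space, second_countable_topology}, 'n::finite) atlas \<Rightarrow> 'g monoid \<Rightarrow>
     'g metric_tensor \<Rightarrow> nat \<Rightarrow> (nat \<Rightarrow> 'g vfield) \<Rightarrow> bool" where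
  "left_invariant_orthonormal_frame \<A> G g n e \<longleftrightarrow>
     (\<forall>i\<in>{1..n}. e i \<in> lie_algebra_of \<A> G) \<and>
     (\<forall>i\<in>{1..n}. \<forall>j\<in>{1..n}. \<forall>p. g (e i) (e j) p = (if i = j then 1 else 0)) \<and>
     (\<forall>X\<in>vector_fields \<A>. \<exists>c. (\<forall>i\<in>{1..n}. c i \<in> smooth_functions \<A>) \<and>
        X = (\<Sum>i\<in>{1..n}. vf_mult (c i) (e i)))"

section \<open>Clifford algebras and their representations\<close>

text \<open>An element of the Clifford algebra \<open>Cl\<^sub>n\<close> (with \<open>v \<cdot> v = - |v|\<^sup>2\<close>) is given by its coefficients in
  the basis of the ordered products \<open>e\<^sub>A = e\<^sub>a \<cdot> e\<^sub>b \<cdot> ...\<close> over \<open>A = {a < b < ...} \<subseteq> {1..n}\<close>. Reordering the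
  product of \<open>e\<^sub>A\<close> and \<open>e\<^sub>B\<close> costs a sign for every \<open>i \<in> A\<close>, \<open>j \<in> B\<close> with \<open>j < i\<close>, and
  \<open>e\<^sub>i \<cdot> e\<^sub>i = - 1\<close> gives one for every \<open>i \<in> A \<inter> B\<close>.\<close>

type_synonym clifford = "nat set \<Rightarrow> real"

definition clifford_algebra :: "nat \<Rightarrow> clifford set"
  where "clifford_algebra n = {a. \<forall>A. \<not> A \<subseteq> {1..n} \<longrightarrow> a A = 0}"

definition blade :: "nat set \<Rightarrow> clifford"
  where "blade A = (\<lambda>B. if B = A then 1 else 0)"

definition blade_sign :: "nat set \<Rightarrow> nat set \<Rightarrow> real"
  where "blade_sign A B = (- 1) ^ card {(i, j). i \<in> A \<and> j \<in> B \<and> j \<le> i}"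

definition clifford_mult :: "nat \<Rightarrow> clifford \<Rightarrow> clifford \<Rightarrow> clifford" where
  "clifford_mult n a b = (\<Sum>A\<in>Pow {1..n}. \<Sum>B\<in>Pow {1..n}.
     (a A * b B * blade_sign A B) *\<^sub>R blade ((A - B) \<union> (B - A)))"

definition clifford_rep :: "nat \<Rightarrow> (clifford \<Rightarrow> 'w::real_vector \<Rightarrow> 'w) \<Rightarrow> bool" where
  "clifford_rep n \<rho> \<longleftrightarrow>
     (\<forall>a\<in>clifford_algebra n. linear (\<rho> a)) \<and>
     (\<forall>a\<in>clifford_algebra n. \<forall>b\<in>clifford_algebra n. \<rho> (a + b) = \<rho> a + \<rho> b) \<and>
     (\<forall>a\<in>clifford_algebra n. \<forall>c::real. \<rho> (c *\<^sub>R a) = c *\<^sub>R \<rho> a) \<and>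
     (\<forall>a\<in>clifford_algebra n. \<forall>b\<in>clifford_algebra n. \<rho> (clifford_mult n a b) = \<rho> a \<circ> \<rho> b) \<and>
     \<rho> (blade {}) = id"

definition irreducible_clifford_rep :: "nat \<Rightarrow> (clifford \<Rightarrow> 'w::real_vector \<Rightarrow> 'w) \<Rightarrow> bool" where
  "irreducible_clifford_rep n \<rho> \<longleftrightarrow> clifford_rep n \<rho> \<and> (UNIV :: 'w set) \<noteq> {0} \<and>
     (\<forall>S. subspace S \<and> (\<forall>a\<in>clifford_algebra n. \<rho> a ` S \<subseteq> S) \<longrightarrow> S = {0} \<or> S = UNIV)"

section \<open>Spinors and the Dirac operator\<close>

text \<open>Spinors on \<open>\<Gamma>\G\<close> for the trivial spin structure.\<close>

definition spinors ::
  "('g::{t2_space, second_countable_topology}, 'n::finite) atlas \<Rightarrow> 'g monoid \<Rightarrow> 'g set \<Rightarrow>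
     ('g \<Rightarrow> 'w::euclidean_space) set" where
  "spinors \<A> G \<Gamma> = {\<phi>. (\<forall>b\<in>Basis. (\<lambda>x. \<phi> x \<bullet> b) \<in> smooth_functions \<A>) \<and>
     (\<forall>\<gamma>\<in>\<Gamma>. \<forall>x. \<phi> (\<gamma> \<otimes>\<^bsub>G\<^esub> x) = \<phi> x)}"

definition vf_apply :: "'g vfield \<Rightarrow> ('g \<Rightarrow> 'w::euclidean_space) \<Rightarrow> 'g \<Rightarrow> 'w"
  where "vf_apply X \<phi> = (\<lambda>p. \<Sum>b\<in>Basis. X (\<lambda>x. \<phi> x \<bullet> b) p *\<^sub>R b)"

definition spin_connection ::
  "nat \<Rightarrow> (clifford \<Rightarrow> 'w::euclidean_space \<Rightarrow> 'w) \<Rightarrow> 'g metric_tensor \<Rightarrow>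
     ('g vfield \<Rightarrow> 'g vfield \<Rightarrow> 'g vfield) \<Rightarrow> (nat \<Rightarrow> 'g vfield) \<Rightarrow>
     'g vfield \<Rightarrow> ('g \<Rightarrow> 'w) \<Rightarrow> 'g \<Rightarrow> 'w" where
  "spin_connection n \<rho> g con e X \<phi> = (\<lambda>p. vf_apply X \<phi> p +
     (1 / 2) *\<^sub>R (\<Sum>j\<in>{1..n}. \<Sum>k\<in>{j<..n}.
        g (con X (e j)) (e k) p *\<^sub>R \<rho> (blade {j}) (\<rho> (blade {k}) (\<phi> p))))"

definition dirac ::
  "nat \<Rightarrow> (clifford \<Rightarrow> 'w::euclidean_space \<Rightarrow> 'w) \<Rightarrow> 'g metric_tensor \<Rightarrow>
     ('g vfield \<Rightarrow> 'g vfield \<Rightarrow> 'g vfield) \<Rightarrow> (nat \<Rightarrow> 'g vfield) \<Rightarrow> ('g \<Rightarrow> 'w) \<Rightarrow> 'g \<Rightarrow> 'w" where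
  "dirac n \<rho> g con e \<phi> =
     (\<lambda>p. \<Sum>i\<in>{1..n}. \<rho> (blade {i}) (spin_connection n \<rho> g con e (e i) \<phi> p))"

end

(*
A left-invariant spinor is a constant phi in W, and on it the Dirac operator acts, up to a scalar, as
Clifford multiplication by the 3-form with coefficients T_ijk = <[x_i, x_j], x_k> + cyclic, because
tr ad = 0 on a nilpotent Lie algebra.  In an orthonormal basis adapted to a flag of ideals, T_ijk for
i < j < k is a single structure constant, so T is the whole bracket.  The Clifford square of T is
N = |T|^2 plus a 4-form 2 Q, and Q^2 is the scalar |Q|^2; hence T phi = 0 with phi nonzero forces
N^2 = 4 |Q|^2.  After rotating the basis so that only x_1 acts on x_4, this equation and the Jacobi
identity leave exactly the structure constants of L51, L52, L53, L54, L56.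
*)

theory Submission
  imports Defs
begin

section \<open>Five-dimensional vectors\<close>

text \<open>The case analysis therefore runs on the constants of an orthonormal basis, and each
  surviving case gets an explicit isomorphism that need not respect the metric. That Q^2 is a scalar
  is special to dimension five: two distinct 4-element sets of indices share exactly three, so their
  blades anticommute and the cross terms cancel. This replaces the spinor equation by one polynomial
  equation in the structure constants. Write g for the x_5 component of [x_1, x_4] and c23 for that
  of [x_2, x_3]. If g or c23 is zero, the equation is the equality case of an AM-GM estimate and
  forces rigid relations. If both are nonzero, every algebra of that shape is L51, L53 or L56. A
  rotation is admissible only in a plane where the flag survives. For x_2, x_3 this means that
  [x_1, x_2] has no x_3 component; if it has one, the Jacobi identity already gives [x_3, x_4] =
  0.\<close>

lemma exhaust_5:
  fixes x :: 5
  shows "x = 1 \<or> x = 2 \<or> x = 3 \<or> x = 4 \<or> x = 5"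
proof (induct x)
  case (of_int z)
  then have "0 \<le> z" and "z < 5" by simp_all
  then have "z = 0 \<or> z = 1 \<or> z = 2 \<or> z = 3 \<or> z = 4" by arith
  then show ?case by auto
qed

lemma forall_5: "(\<forall>i::5. P i) \<longleftrightarrow> P 1 \<and> P 2 \<and> P 3 \<and> P 4 \<and> P 5"
  by (metis exhaust_5)

lemma UNIV_5: "UNIV = {1::5, 2, 3, 4, 5}"
  using exhaust_5 by auto

lemma sum_5: "sum f (UNIV :: 5 set) = f 1 + (f 2 + (f 3 + (f 4 + f 5)))"
  unfolding UNIV_5 by simp

lemma vector_5 [simp]:
  "(vector [x1, x2, x3, x4, x5] :: 'a::zero ^ 5) $ 1 = x1"
  "(vector [x1, x2, x3, x4, x5] :: 'a ^ 5) $ 2 = x2"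
  "(vector [x1, x2, x3, x4, x5] :: 'a ^ 5) $ 3 = x3"
  "(vector [x1, x2, x3, x4, x5] :: 'a ^ 5) $ 4 = x4"
  "(vector [x1, x2, x3, x4, x5] :: 'a ^ 5) $ 5 = x5"
  unfolding vector_def by simp_all

lemma vec_eq_5: "(u :: 'a ^ 5) = v \<longleftrightarrow> u $ 1 = v $ 1 \<and> u $ 2 = v $ 2 \<and> u $ 3 = v $ 3 \<and> u $ 4 = v $ 4 \<and> u $ 5 = v $ 5"
  by (simp add: vec_eq_iff forall_5)

section \<open>Nilpotent brackets in normal form\<close>

text \<open>Isomorphisms are kept in the direction from the model \<open>m\<close> into \<open>L\<close>, where they are total linear maps.\<close>

definition lie_param ::
  "('m::real_vector \<Rightarrow> 'm \<Rightarrow> 'm) \<Rightarrow> 'l::real_vector set \<Rightarrow> ('l \<Rightarrow> 'l \<Rightarrow> 'l) \<Rightarrow> ('m \<Rightarrow> 'l) \<Rightarrow> bool" where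
  "lie_param m L br F \<longleftrightarrow> linear F \<and> inj F \<and> range F = L \<and> (\<forall>y z. F (m y z) = br (F y) (F z))"

lemma lie_param_imp_isomorphic:
  assumes "lie_param m L br F"
  shows "lie_isomorphic L br UNIV m"
proof -
  have F: "linear F" "inj F" "range F = L" and hom: "\<And>y z. F (m y z) = br (F y) (F z)"
    using assms by (auto simp: lie_param_def)
  have L: "\<exists>y. X = F y" if "X \<in> L" for X using that F(3) by auto
  have "bij_betw (inv_into UNIV F) L UNIV"
    using F bij_betw_inv_into[of F UNIV L] by (simp add: bij_betw_def)
  moreover have "inv_into UNIV F (X + Y) = inv_into UNIV F X + inv_into UNIV F Y \<and>
      inv_into UNIV F (br X Y) = m (inv_into UNIV F X) (inv_into UNIV F Y)"
    if "X \<in> L" "Y \<in> L" for X Y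
    using L[OF that(1)] L[OF that(2)] F(2)
    by (auto simp flip: linear_add[OF F(1)] hom)
  moreover have "inv_into UNIV F (c *\<^sub>R X) = c *\<^sub>R inv_into UNIV F X" if "X \<in> L" for X c
    using L[OF that] F(2) by (auto simp flip: linear_scale[OF F(1)])
  ultimately show ?thesis unfolding lie_isomorphic_def by blast
qed

lemma lie_param_trans:
  assumes "lie_param m UNIV m' F" "lie_param m' L br F'"
  shows "lie_param m L br (F' \<circ> F)"
proof -
  have F: "linear F" "inj F" "range F = UNIV" "\<And>y z. F (m y z) = m' (F y) (F z)"
    and F': "linear F'" "inj F'" "range F' = L" "\<And>y z. F' (m' y z) = br (F' y) (F' z)"
    using assms by (auto simp: lie_param_def)
  have "range (F' \<circ> F) = L"
    by (simp only: image_comp[symmetric] F(3) F'(3))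
  then show ?thesis
    using F F' by (simp add: lie_param_def linear_compose inj_compose)
qed

lemma lie_param_real5:
  fixes F :: "real ^ 5 \<Rightarrow> real ^ 5"
  assumes "linear F" "\<And>y. F y = 0 \<Longrightarrow> y = 0" "\<And>y z. F (m y z) = m' (F y) (F z)"
  shows "lie_param m UNIV m' F"
  using assms unfolding lie_param_def
  by (metis linear_injective_0 linear_injective_imp_surjective)

text \<open>The bracket whose structure constants are those of an adapted basis in normal form (see \<open>adapted\<close>
  below, with \<open>g\<^sub>2 = g\<^sub>3 = 0\<close>).\<close>

definition tri_bracket ::
  "real \<Rightarrow> real \<Rightarrow> real \<Rightarrow> real \<Rightarrow> real \<Rightarrow> real \<Rightarrow> real \<Rightarrow> real \<Rightarrow> real ^ 5 \<Rightarrow> real ^ 5 \<Rightarrow> real ^ 5" where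
  "tri_bracket a b12 b13 b23 c12 c13 c23 g y z = vector [0, 0, a * wedge 1 2 y z,
     b12 * wedge 1 2 y z + b13 * wedge 1 3 y z + b23 * wedge 2 3 y z,
     c12 * wedge 1 2 y z + c13 * wedge 1 3 y z + c23 * wedge 2 3 y z + g * wedge 1 4 y z]"

section \<open>Explicit isomorphisms from the models to the normal forms\<close>

lemmas L5_simps = L51_def L52_def L53_def L54_def L56_def bracket_of_diffs_def tri_bracket_def wedge_def
  vec_eq_5

text \<open>All brackets lie along x_5 and are given by a 2-form on the first four coordinates. Its
  square is \<open>2 * c23 * g\<close> times the volume form, so it is symplectic, and the witness
  lists a Darboux basis.\<close>

lemma tri_L51:
  assumes "c23 \<noteq> 0" "g \<noteq> 0"
  shows "\<exists>F. lie_param L51 UNIV (tri_bracket 0 0 0 0 c12 c13 c23 g) F"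
proof -
  let ?F = "\<lambda>y :: real ^ 5. vector [y $ 1, y $ 3, - y $ 4 / c23, (c13 / c23 * y $ 4 - c12 * y $ 3 - y $ 2) / g, y $ 5] :: real ^ 5"
  have "lie_param L51 UNIV (tri_bracket 0 0 0 0 c12 c13 c23 g) ?F"
  proof (rule lie_param_real5)
    show "linear ?F"
      by (rule linearI) (use assms in \<open>simp_all add: vec_eq_5 field_simps\<close>)
    show "y = 0" if "?F y = 0" for y
      using that assms by (auto simp: vec_eq_5)
    show "?F (L51 y z) = tri_bracket 0 0 0 0 c12 c13 c23 g (?F y) (?F z)" for y z
      using assms by (simp add: L5_simps field_simps)
  qed
  then show ?thesis by blast
qed

text \<open>On the first three coordinates the bracket is \<open>(b \<bullet> (u \<times> v), c \<bullet> (u \<times> v))\<close> for two vectors \<open>b\<close>, \<open>c\<close>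
  of \<open>\<real>\<^sup>3\<close>; the new basis is \<open>n = b \<times> c\<close>, \<open>b\<close>, \<open>c\<close>.\<close>

lemma tri_L52_two_step:
  assumes "b12 * c13 \<noteq> c12 * b13 \<or> b12 * c23 \<noteq> c12 * b23 \<or> b13 * c23 \<noteq> c13 * b23"
  shows "\<exists>F. lie_param L52 UNIV (tri_bracket 0 b12 b13 b23 c12 c13 c23 0) F"
proof -
  define n1 where "n1 = b12 * c13 - b13 * c12"
  define n2 where "n2 = b12 * c23 - b23 * c12"
  define n3 where "n3 = b13 * c23 - b23 * c13"
  define N where "N = n1\<^sup>2 + n2\<^sup>2 + n3\<^sup>2"
  have N: "N \<noteq> 0"
    using assms by (auto simp: N_def n1_def n2_def n3_def add_nonneg_eq_0_iff mult.commute)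
  let ?F = "\<lambda>y :: real ^ 5. vector [n1 * y $ 1 + b23 * y $ 2 + c23 * y $ 3,
     n2 * y $ 1 - b13 * y $ 2 - c13 * y $ 3,
     n3 * y $ 1 + b12 * y $ 2 + c12 * y $ 3, N * y $ 5, - N * y $ 4] :: real ^ 5"
  have "lie_param L52 UNIV (tri_bracket 0 b12 b13 b23 c12 c13 c23 0) ?F"
  proof (rule lie_param_real5)
    show "linear ?F"
      by (rule linearI) (simp_all add: vec_eq_5 algebra_simps)
    show "y = 0" if "?F y = 0" for y
    proof -
      have e: "n1 * y $ 1 + b23 * y $ 2 + c23 * y $ 3 = 0"
        "n2 * y $ 1 - b13 * y $ 2 - c13 * y $ 3 = 0" "n3 * y $ 1 + b12 * y $ 2 + c12 * y $ 3 = 0"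
        "y $ 4 = 0" "y $ 5 = 0"
        using that N by (auto simp: vec_eq_5)
      let ?l1 = "n1 * y $ 1 + b23 * y $ 2 + c23 * y $ 3"
      let ?l2 = "n2 * y $ 1 - b13 * y $ 2 - c13 * y $ 3"
      let ?l3 = "n3 * y $ 1 + b12 * y $ 2 + c12 * y $ 3"
      \<comment> \<open>Cramer's rule: the coefficient rows are n, c \<times> n and n \<times> b,
        the adjugate of the matrix with columns n, b, c, whose determinant is
        \<open>N\<close>.\<close>
      have "N * y $ 1 = n1 * ?l1 + n2 * ?l2 + n3 * ?l3"
        "N * y $ 2 = (- c13 * n3 - c12 * n2) * ?l1 + (c12 * n1 - c23 * n3) * ?l2 + (c23 * n2 + c13 * n1) * ?l3"
        "N * y $ 3 = (n2 * b12 + n3 * b13) * ?l1 + (n3 * b23 - n1 * b12) * ?l2 + (- n1 * b13 - n2 * b23) * ?l3"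
        unfolding N_def n1_def n2_def n3_def by (simp_all add: algebra_simps power2_eq_square)
      then have "N * y $ 1 = 0" "N * y $ 2 = 0" "N * y $ 3 = 0"
        unfolding e by simp_all
      then show ?thesis using e N by (simp add: vec_eq_5)
    qed
    show "?F (L52 y z) = tri_bracket 0 b12 b13 b23 c12 c13 c23 0 (?F y) (?F z)" for y z
      unfolding L5_simps N_def n1_def n2_def n3_def by (simp add: algebra_simps power2_eq_square)
  qed
  then show ?thesis by blast
qed

text \<open>The third hypothesis says [x_1, [x_1, x_2]] = 0. Hence [x_1, x_2] and [x_1, x_4] are
  central and independent, and x_1, x_2, x_4 generate the algebra.\<close>

lemma tri_L52:
  assumes "a \<noteq> 0" "g \<noteq> 0" "a * c13 + b * g = 0"
  shows "\<exists>F. lie_param L52 UNIV (tri_bracket a b 0 0 0 c13 0 g) F"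
proof -
  let ?F = "\<lambda>y :: real ^ 5. vector [y $ 1, y $ 2, - a * y $ 4, y $ 3 - b * y $ 4, - g * y $ 5] :: real ^ 5"
  have "lie_param L52 UNIV (tri_bracket a b 0 0 0 c13 0 g) ?F"
  proof (rule lie_param_real5)
    show "linear ?F"
      by (rule linearI) (simp_all add: vec_eq_5 algebra_simps)
    show "y = 0" if "?F y = 0" for y
      using that assms by (auto simp: vec_eq_5)
    show "?F (L52 y z) = tri_bracket a b 0 0 0 c13 0 g (?F y) (?F z)" for y z
      using assms(3) unfolding L5_simps by simp algebra
  qed
  then show ?thesis by blast
qed

text \<open>In the plane of x_2 and x_3 the second new vector is (b12, b13) and the third is
  orthogonal to it, so that its bracket with x_1 has no x_4 component. The factor
  \<open>g / c23\<close> balances the two brackets that must both give the last vector, and the x_4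
  component \<open>\<delta>\<close> of the third vector makes it commute with x_1.\<close>

lemma tri_L53_two_step_quotient:
  assumes "b12 \<noteq> 0 \<or> b13 \<noteq> 0" "c23 \<noteq> 0" "g \<noteq> 0"
  shows "\<exists>F. lie_param L53 UNIV (tri_bracket 0 b12 b13 0 c12 c13 c23 g) F"
proof -
  define \<beta> where "\<beta> = b12\<^sup>2 + b13\<^sup>2"
  define \<delta> where "\<delta> = (c13 * b12 - c12 * b13) / c23"
  have \<beta>: "\<beta> \<noteq> 0" using assms by (auto simp: \<beta>_def add_nonneg_eq_0_iff)
  have \<delta>: "\<delta> * c23 = c13 * b12 - c12 * b13" using assms by (simp add: \<delta>_def)
  let ?F = "\<lambda>y :: real ^ 5. vector [y $ 1, b12 * y $ 2 + g * b13 / c23 * y $ 3, b13 * y $ 2 - g * b12 / c23 * y $ 3,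
     \<delta> * y $ 3 - \<beta> * y $ 4, - (c12 * b12 + c13 * b13) * y $ 4 + \<beta> * g * y $ 5] :: real ^ 5"
  have "lie_param L53 UNIV (tri_bracket 0 b12 b13 0 c12 c13 c23 g) ?F"
  proof (rule lie_param_real5)
    show "linear ?F"
      by (rule linearI) (simp_all add: vec_eq_5 algebra_simps)
    show "y = 0" if "?F y = 0" for y
    proof -
      have e: "y $ 1 = 0" "b12 * y $ 2 + g * b13 / c23 * y $ 3 = 0" "b13 * y $ 2 - g * b12 / c23 * y $ 3 = 0"
        "\<delta> * y $ 3 - \<beta> * y $ 4 = 0" "- (c12 * b12 + c13 * b13) * y $ 4 + \<beta> * g * y $ 5 = 0"
        using that by (auto simp: vec_eq_5)
      have "\<beta> * y $ 2 = 0" "\<beta> * (g / c23 * y $ 3) = 0"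
        using e(2,3) unfolding \<beta>_def by (algebra, algebra)
      then show ?thesis using e \<beta> assms by (auto simp: vec_eq_5)
    qed
    show "?F (L53 y z) = tri_bracket 0 b12 b13 0 c12 c13 c23 g (?F y) (?F z)" for y z
      using \<delta> assms(2) unfolding L5_simps \<beta>_def by (simp add: field_simps) algebra
  qed
  then show ?thesis by blast
qed

text \<open>Here x_2 takes the role of the first vector, since [x_2, [x_1, x_2]] is nonzero.
  Subtracting \<open>r\<close> times x_2 from x_1 makes it commute with [x_1, x_2].\<close>

lemma tri_L53:
  assumes "a \<noteq> 0" "c23 \<noteq> 0" "g \<noteq> 0"
  shows "\<exists>F. lie_param L53 UNIV (tri_bracket a b12 0 0 c12 c13 c23 g) F"
proof -
  define r where "r = (a * c13 + b12 * g) / (a * c23)"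
  have r: "r * a * c23 = a * c13 + b12 * g" using assms by (simp add: r_def)
  let ?F = "\<lambda>y :: real ^ 5. vector [y $ 2, y $ 1 - r * y $ 2, a * y $ 4, b12 * y $ 4 + a * c23 / g * y $ 3,
     c12 * y $ 4 - a * c23 * y $ 5] :: real ^ 5"
  have "lie_param L53 UNIV (tri_bracket a b12 0 0 c12 c13 c23 g) ?F"
  proof (rule lie_param_real5)
    show "linear ?F"
      by (rule linearI) (simp_all add: vec_eq_5 algebra_simps)
    show "y = 0" if "?F y = 0" for y
      using that assms by (auto simp: vec_eq_5)
    show "?F (L53 y z) = tri_bracket a b12 0 0 c12 c13 c23 g (?F y) (?F z)" for y z
      using r assms(3) unfolding L5_simps by (simp add: field_simps) algebra
  qed
  then show ?thesis by blast
qed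

text \<open>The algebra is filiform: starting with x_2, each new vector is minus the bracket of x_1
  with the previous one.\<close>

lemma tri_L54:
  assumes "a \<noteq> 0" "b13 \<noteq> 0" "g \<noteq> 0"
  shows "\<exists>F. lie_param L54 UNIV (tri_bracket a b12 b13 0 c12 c13 0 g) F"
proof -
  let ?F = "\<lambda>y :: real ^ 5. vector [y $ 1, y $ 2, - a * y $ 3, a * b13 * y $ 4 - b12 * y $ 3,
     (a * c13 + b12 * g) * y $ 4 - c12 * y $ 3 - a * b13 * g * y $ 5] :: real ^ 5"
  have "lie_param L54 UNIV (tri_bracket a b12 b13 0 c12 c13 0 g) ?F"
  proof (rule lie_param_real5)
    show "linear ?F"
      by (rule linearI) (simp_all add: vec_eq_5 algebra_simps)
    show "y = 0" if "?F y = 0" for y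
      using that assms by (auto simp: vec_eq_5)
    show "?F (L54 y z) = tri_bracket a b12 b13 0 c12 c13 0 g (?F y) (?F z)" for y z
      unfolding L5_simps by simp algebra
  qed
  then show ?thesis by blast
qed

text \<open>The chain of iterated brackets with x_1 is built as for \<open>L54\<close>, but starts
  at \<open>\<mu>\<close> times x_2. The bracket of the second and third vectors is quadratic in
  \<open>\<mu>\<close> and the last vector is linear, so this value of \<open>\<mu>\<close> makes
  them match.\<close>

lemma tri_L56:
  assumes "a \<noteq> 0" "b13 \<noteq> 0" "c23 \<noteq> 0" "g \<noteq> 0"
  shows "\<exists>F. lie_param L56 UNIV (tri_bracket a b12 b13 0 c12 c13 c23 g) F"
proof -
  define \<mu> where "\<mu> = - b13 * g / c23"
  have \<mu>: "\<mu> * c23 = - b13 * g" "\<mu> \<noteq> 0" using assms by (simp_all add: \<mu>_def)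
  let ?F = "\<lambda>y :: real ^ 5. vector [y $ 1, \<mu> * y $ 2, - \<mu> * a * y $ 3, \<mu> * (a * b13 * y $ 4 - b12 * y $ 3),
     \<mu> * ((a * c13 + b12 * g) * y $ 4 - c12 * y $ 3 - a * b13 * g * y $ 5)] :: real ^ 5"
  have "lie_param L56 UNIV (tri_bracket a b12 b13 0 c12 c13 c23 g) ?F"
  proof (rule lie_param_real5)
    show "linear ?F"
      by (rule linearI) (simp_all add: vec_eq_5 algebra_simps)
    show "y = 0" if "?F y = 0" for y
      using that assms \<mu> by (auto simp: vec_eq_5)
    show "?F (L56 y z) = tri_bracket a b12 b13 0 c12 c13 c23 g (?F y) (?F z)" for y z
      using \<mu>(1) unfolding L5_simps by simp algebra
  qed
  then show ?thesis by blast
qed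

text \<open>For \<open>g = 0\<close> the right-hand side is 4 |b \<times> c|^2, at most (|b|^2 +
  |c|^2)^2, so equality leaves no room for \<open>a\<close>. For nonzero \<open>g\<close> the Jacobi
  identity removes \<open>b23\<close>. If also \<open>c23 = 0\<close>, a single square remains on
  the right and a root can be taken; otherwise the vanishing of \<open>a\<close>, \<open>b12\<close>
  and \<open>b13\<close> decides between the models.\<close>

lemma tri_bracket_cases:
  fixes a b12 b13 b23 c12 c13 c23 g :: real
  defines "N \<equiv> a\<^sup>2 + b12\<^sup>2 + b13\<^sup>2 + b23\<^sup>2 + c12\<^sup>2 + c13\<^sup>2 + c23\<^sup>2 + g\<^sup>2"
  assumes jacobi: "b23 * g = 0" and "N \<noteq> 0"
    and N: "N\<^sup>2 = 4 * ((b12 * c13 - a * g - c12 * b13)\<^sup>2 + (c12 * b23 - b12 * c23)\<^sup>2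
      + (b13 * c23 - c13 * b23)\<^sup>2 + (b23 * g)\<^sup>2 + (- (c23 * g))\<^sup>2)"
  shows "\<exists>m\<in>{L51, L52, L53, L54, L56}. \<exists>F. lie_param m UNIV (tri_bracket a b12 b13 b23 c12 c13 c23 g) F"
proof (cases "g = 0")
  case g: True
  define P where "P = b12\<^sup>2 + b13\<^sup>2 + b23\<^sup>2"
  define R where "R = c12\<^sup>2 + c13\<^sup>2 + c23\<^sup>2"
  define d where "d = b12 * c12 + b13 * c13 + b23 * c23"
  have PR: "P \<ge> 0" "R \<ge> 0" by (simp_all add: P_def R_def)
  \<comment> \<open>Lagrange's identity for |b \<times> c|^2, with \<open>P\<close>,
    \<open>R\<close> and \<open>d\<close> standing for |b|^2, |c|^2 and the inner product of b and
    c.\<close>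
  have "4 * ((b12 * c13 - c12 * b13)\<^sup>2 + (c12 * b23 - b12 * c23)\<^sup>2 + (b13 * c23 - c13 * b23)\<^sup>2) = 4 * (P * R - d\<^sup>2)"
    unfolding P_def R_def d_def by (simp add: algebra_simps power2_eq_square)
  then have "(a\<^sup>2 + P + R)\<^sup>2 = 4 * (P * R - d\<^sup>2)"
    using N g by (simp add: N_def P_def R_def add.assoc)
  then have "a ^ 4 + 2 * a\<^sup>2 * (P + R) + (P - R)\<^sup>2 + 4 * d\<^sup>2 = 0"
    by (simp add: algebra_simps power2_eq_square power4_eq_xxxx)
  moreover have "2 * a\<^sup>2 * (P + R) \<ge> 0" "(P - R)\<^sup>2 \<ge> 0" "4 * d\<^sup>2 \<ge> 0" "a ^ 4 \<ge> 0"
    using PR by (simp_all add: zero_le_even_power)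
  ultimately have a: "a ^ 4 = 0" by linarith
  \<comment> \<open>Otherwise b \<times> c = 0, and with \<open>g = 0\<close> the equation would
    give \<open>N = 0\<close>.\<close>
  have "b12 * c13 \<noteq> c12 * b13 \<or> b12 * c23 \<noteq> c12 * b23 \<or> b13 * c23 \<noteq> c13 * b23"
    using \<open>N \<noteq> 0\<close> N g a by auto
  then show ?thesis
    using tri_L52_two_step a g by auto
next
  case g: False
  then have b23: "b23 = 0" using jacobi by simp
  show ?thesis
  proof (cases "c23 = 0")
    case c23: True
    \<comment> \<open>This is the equality case of an AM-GM bound, so \<open>N \<plusminus> 2 q\<close> is a vanishing sum of squares.\<close>
    have "N\<^sup>2 = (2 * (b12 * c13 - a * g - c12 * b13))\<^sup>2"
      using N b23 c23 by (simp only: power_mult_distrib[of 2]) simp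
    then consider "N = 2 * (b12 * c13 - a * g - c12 * b13)" | "N = - 2 * (b12 * c13 - a * g - c12 * b13)"
      by (auto simp: power2_eq_iff)
    then have "a = - g \<and> c13 = b12 \<and> b13 = - c12 \<or> a = g \<and> c13 = - b12 \<and> b13 = c12"
    proof cases
      case 1
      then have "(a + g)\<^sup>2 + (c13 - b12)\<^sup>2 + (b13 + c12)\<^sup>2 = 0"
        using b23 c23 by (simp add: N_def algebra_simps power2_eq_square)
      then show ?thesis by (auto simp: add_nonneg_eq_0_iff)
    next
      case 2
      then have "(a - g)\<^sup>2 + (c13 + b12)\<^sup>2 + (b13 - c12)\<^sup>2 = 0"
        using b23 c23 by (simp add: N_def algebra_simps power2_eq_square)
      then show ?thesis by (auto simp: add_nonneg_eq_0_iff)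
    qed
    \<comment> \<open>In both sign patterns the two products in \<open>r\<close> cancel, which is
      the hypothesis of \<open>tri_L52\<close>; the vanishing of \<open>c12\<close> then separates
      \<open>L52\<close> from \<open>L54\<close>.\<close>
    then have a: "a \<noteq> 0" and r: "a * c13 + b12 * g = 0" and bc: "b13 = 0 \<longleftrightarrow> c12 = 0"
      using g by auto
    show ?thesis
    proof (cases "c12 = 0")
      case True
      then show ?thesis using tri_L52[OF a g r] bc b23 c23 by auto
    next
      case False
      then show ?thesis using tri_L54[OF a _ g] bc b23 c23 by auto
    qed
  next
    case c23: False
    show ?thesis
    proof (cases "a = 0")
      case True
      then show ?thesis
        using tri_L51[OF c23 g] tri_L53_two_step_quotient[OF _ c23 g] b23 by (cases "b12 = 0 \<and> b13 = 0") auto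
    next
      case False
      then show ?thesis
        using tri_L56[OF _ _ c23 g] tri_L53[OF _ c23 g] b23 by (cases "b13 = 0") auto
    qed
  qed
qed

section \<open>Squares of forms in the Clifford algebra\<close>

text \<open>Every 3-blade squares to +1. Two different 3-blades on five indices share two indices or
  one. In the first case they anticommute and their cross terms cancel; in the second they commute,
  and each cross term is a 4-blade that occurs twice. The relations \<open>anti\<close> serve as
  rewrite rules that sort the indices.\<close>

lemma clifford_three_form_square:
  fixes E1 E2 E3 E4 E5 :: "'w::real_vector \<Rightarrow> 'w"
  assumes lin: "linear E1" "linear E2" "linear E3" "linear E4" "linear E5"
    and sq: "\<And>w. E1 (E1 w) = - w" "\<And>w. E2 (E2 w) = - w" "\<And>w. E3 (E3 w) = - w"
      "\<And>w. E4 (E4 w) = - w" "\<And>w. E5 (E5 w) = - w"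
    and anti: "\<And>w. E2 (E1 w) = - E1 (E2 w)" "\<And>w. E3 (E1 w) = - E1 (E3 w)"
      "\<And>w. E4 (E1 w) = - E1 (E4 w)" "\<And>w. E5 (E1 w) = - E1 (E5 w)"
      "\<And>w. E3 (E2 w) = - E2 (E3 w)" "\<And>w. E4 (E2 w) = - E2 (E4 w)"
      "\<And>w. E5 (E2 w) = - E2 (E5 w)" "\<And>w. E4 (E3 w) = - E3 (E4 w)"
      "\<And>w. E5 (E3 w) = - E3 (E5 w)" "\<And>w. E5 (E4 w) = - E4 (E5 w)"
    and \<Theta>: "\<And>w. \<Theta> w = a *\<^sub>R E1 (E2 (E3 w)) + b12 *\<^sub>R E1 (E2 (E4 w)) + b13 *\<^sub>R E1 (E3 (E4 w))
      + b23 *\<^sub>R E2 (E3 (E4 w)) + c12 *\<^sub>R E1 (E2 (E5 w)) + c13 *\<^sub>R E1 (E3 (E5 w))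
      + c23 *\<^sub>R E2 (E3 (E5 w)) + g *\<^sub>R E1 (E4 (E5 w))"
    and Q: "\<And>w. Q w = (b12 * c13 - a * g - c12 * b13) *\<^sub>R E2 (E3 (E4 (E5 w)))
      + (c12 * b23 - b12 * c23) *\<^sub>R E1 (E3 (E4 (E5 w)))
      + (b13 * c23 - c13 * b23) *\<^sub>R E1 (E2 (E4 (E5 w)))
      + (b23 * g) *\<^sub>R E1 (E2 (E3 (E5 w))) - (c23 * g) *\<^sub>R E1 (E2 (E3 (E4 w)))"
  shows "\<Theta> (\<Theta> w) = (a\<^sup>2 + b12\<^sup>2 + b13\<^sup>2 + b23\<^sup>2 + c12\<^sup>2 + c13\<^sup>2 + c23\<^sup>2 + g\<^sup>2) *\<^sub>R w + (Q w + Q w)"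
proof -
  note simps = lin[THEN linear_add] lin[THEN linear_scale] lin[THEN linear_neg] sq anti
  show ?thesis
    unfolding \<Theta> Q
    by (simp only: simps minus_minus scaleR_minus_right scaleR_add_right scaleR_scaleR)
      (simp add: algebra_simps power2_eq_square)
qed

text \<open>Every 4-blade squares to +1, and two different ones on five indices share exactly three
  indices and hence anticommute.\<close>

lemma clifford_four_form_square:
  fixes E1 E2 E3 E4 E5 :: "'w::real_vector \<Rightarrow> 'w"
  assumes lin: "linear E1" "linear E2" "linear E3" "linear E4" "linear E5"
    and sq: "\<And>w. E1 (E1 w) = - w" "\<And>w. E2 (E2 w) = - w" "\<And>w. E3 (E3 w) = - w"
      "\<And>w. E4 (E4 w) = - w" "\<And>w. E5 (E5 w) = - w"
    and anti: "\<And>w. E2 (E1 w) = - E1 (E2 w)" "\<And>w. E3 (E1 w) = - E1 (E3 w)"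
      "\<And>w. E4 (E1 w) = - E1 (E4 w)" "\<And>w. E5 (E1 w) = - E1 (E5 w)"
      "\<And>w. E3 (E2 w) = - E2 (E3 w)" "\<And>w. E4 (E2 w) = - E2 (E4 w)"
      "\<And>w. E5 (E2 w) = - E2 (E5 w)" "\<And>w. E4 (E3 w) = - E3 (E4 w)"
      "\<And>w. E5 (E3 w) = - E3 (E5 w)" "\<And>w. E5 (E4 w) = - E4 (E5 w)"
    and Q: "\<And>w. Q w = q1 *\<^sub>R E2 (E3 (E4 (E5 w))) + q2 *\<^sub>R E1 (E3 (E4 (E5 w)))
      + q3 *\<^sub>R E1 (E2 (E4 (E5 w))) + q4 *\<^sub>R E1 (E2 (E3 (E5 w))) + q5 *\<^sub>R E1 (E2 (E3 (E4 w)))"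
  shows "Q (Q w) = (q1\<^sup>2 + q2\<^sup>2 + q3\<^sup>2 + q4\<^sup>2 + q5\<^sup>2) *\<^sub>R w"
proof -
  note simps = lin[THEN linear_add] lin[THEN linear_scale] lin[THEN linear_neg] sq anti
  show ?thesis
    unfolding Q
    by (simp only: simps minus_minus scaleR_minus_right scaleR_add_right scaleR_scaleR)
      (simp add: algebra_simps power2_eq_square)
qed

section \<open>Adapted orthonormal bases\<close>

text \<open>A square matrix with orthonormal rows has orthonormal columns.\<close>

lemma orthonormal_basis_5:
  fixes x :: "5 \<Rightarrow> real ^ 5"
  assumes "\<And>i j. x i \<bullet> x j = (if i = j then 1 else 0)"
  shows orthonormal_columns_5: "(\<Sum>k\<in>UNIV. x k $ m * x k $ n) = (if m = n then 1 else 0)"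
    and orthonormal_expansion_5: "(\<Sum>k\<in>UNIV. (v \<bullet> x k) *\<^sub>R x k) = v"
proof -
  define P where "P = (\<chi> i. x i)"
  have "P ** transpose P = mat 1"
    using assms by (simp add: P_def matrix_matrix_mult_def transpose_def mat_def vec_eq_iff inner_vec_def)
  then have "transpose P ** P = mat 1"
    by (simp add: matrix_left_right_inverse)
  then have *: "(\<Sum>k\<in>UNIV. x k $ m * x k $ n) = (if m = n then 1 else 0)" for m n
    by (simp add: P_def matrix_matrix_mult_def transpose_def mat_def vec_eq_iff)
  then show "(\<Sum>k\<in>UNIV. x k $ m * x k $ n) = (if m = n then 1 else 0)" .
  have "(\<Sum>k\<in>UNIV. (v \<bullet> x k) * x k $ n) = v $ n" for n
  proof -
    have "(\<Sum>k\<in>UNIV. (v \<bullet> x k) * x k $ n) = (\<Sum>k\<in>UNIV. \<Sum>m\<in>UNIV. v $ m * (x k $ m * x k $ n))"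
      by (simp add: inner_vec_def sum_distrib_right mult.assoc)
    also have "\<dots> = (\<Sum>m\<in>UNIV. v $ m * (\<Sum>k\<in>UNIV. x k $ m * x k $ n))"
      by (subst sum.swap) (simp add: sum_distrib_left)
    also have "\<dots> = v $ n"
      by (simp add: * if_distrib[of "(*) _"] cong: if_cong)
    finally show ?thesis .
  qed
  then show "(\<Sum>k\<in>UNIV. (v \<bullet> x k) *\<^sub>R x k) = v"
    by (simp add: vec_eq_iff)
qed

text \<open>Expanding the basis vectors leaves the column products of an orthogonal matrix, which
  are Kronecker deltas. The values are vectors so that both the trace of ad and Clifford expressions
  are covered.\<close>

lemma bilinear_contraction_5:
  fixes x :: "5 \<Rightarrow> real ^ 5" and B :: "real ^ 5 \<Rightarrow> real ^ 5 \<Rightarrow> 'w::real_vector"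
  assumes x: "\<And>i j. x i \<bullet> x j = (if i = j then 1 else 0)" and B: "bilinear B"
  shows "(\<Sum>m\<in>UNIV. B (axis m 1) (axis m 1)) = (\<Sum>k\<in>UNIV. B (x k) (x k))"
proof -
  have B1: "linear (\<lambda>u. B u v)" and B2: "linear (B u)" for u v
    using B by (auto simp: bilinear_def)
  have exp: "(\<Sum>m\<in>UNIV. x k $ m *\<^sub>R axis m 1) = x k" for k
    using basis_expansion[of "x k"] by (simp add: scalar_mult_eq_scaleR)
  have "B (x k) (x k) = (\<Sum>m\<in>UNIV. \<Sum>n\<in>UNIV. (x k $ m * x k $ n) *\<^sub>R B (axis m 1) (axis n 1))" for k
  proof -
    have "B (x k) (x k) = B (\<Sum>m\<in>UNIV. x k $ m *\<^sub>R axis m 1) (\<Sum>n\<in>UNIV. x k $ n *\<^sub>R axis n 1)"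
      by (simp only: exp)
    also have "\<dots> = (\<Sum>m\<in>UNIV. x k $ m *\<^sub>R B (axis m 1) (\<Sum>n\<in>UNIV. x k $ n *\<^sub>R axis n 1))"
      by (simp only: linear_sum[OF B1] linear_scale[OF B1])
    also have "\<dots> = (\<Sum>m\<in>UNIV. \<Sum>n\<in>UNIV. (x k $ m * x k $ n) *\<^sub>R B (axis m 1) (axis n 1))"
      by (simp only: linear_sum[OF B2] linear_scale[OF B2] scaleR_sum_right scaleR_scaleR)
    finally show ?thesis .
  qed
  then have "(\<Sum>k\<in>UNIV. B (x k) (x k))
      = (\<Sum>k\<in>UNIV. \<Sum>m\<in>UNIV. \<Sum>n\<in>UNIV. (x k $ m * x k $ n) *\<^sub>R B (axis m 1) (axis n 1))"
    by simp
  also have "\<dots> = (\<Sum>m\<in>UNIV. \<Sum>n\<in>UNIV. \<Sum>k\<in>UNIV. (x k $ m * x k $ n) *\<^sub>R B (axis m 1) (axis n 1))"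
    by (rule trans[OF sum.swap], rule sum.cong[OF refl], rule sum.swap)
  also have "\<dots> = (\<Sum>m\<in>UNIV. \<Sum>n\<in>UNIV. (if m = n then 1 else 0) *\<^sub>R B (axis m 1) (axis n 1))"
    by (simp only: scaleR_sum_left[symmetric] orthonormal_columns_5[OF x])
  also have "\<dots> = (\<Sum>m\<in>UNIV. B (axis m 1) (axis m 1))"
    by (simp add: if_distrib[of "\<lambda>r. r *\<^sub>R _"] cong: if_cong)
  finally show ?thesis by simp
qed

text \<open>Invariant of the induction: the orthogonal complement I of the vectors chosen so far is
  an ideal. By nilpotency the brackets with I do not span I, so a unit vector of I orthogonal to all
  of them can be chosen next. The rest of the complement is again an ideal, because it still
  contains these brackets.\<close>

lemma nilpotent_adapted_basis:
  fixes br :: "'v::euclidean_space \<Rightarrow> 'v \<Rightarrow> 'v"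
  assumes nil: "nilpotent_lie UNIV br" and "k \<le> DIM('v)"
  shows "\<exists>x :: nat \<Rightarrow> 'v. (\<forall>i<k. \<forall>j<k. x i \<bullet> x j = (if i = j then 1 else 0)) \<and>
    (\<forall>v y. (\<forall>j<k. y \<bullet> x j = 0) \<longrightarrow> (\<forall>j<k. br v y \<bullet> x j = 0)) \<and>
    (\<forall>i<k. \<forall>j\<le>i. \<forall>v. br v (x i) \<bullet> x j = 0)"
  using \<open>k \<le> DIM('v)\<close>
proof (induction k)
  case 0
  then show ?case by simp
next
  case (Suc k)
  from Suc.IH Suc.prems obtain x :: "nat \<Rightarrow> 'v" where *:
    "(\<forall>i<k. \<forall>j<k. x i \<bullet> x j = (if i = j then 1 else 0)) \<and>
      (\<forall>v y. (\<forall>j<k. y \<bullet> x j = 0) \<longrightarrow> (\<forall>j<k. br v y \<bullet> x j = 0)) \<and>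
      (\<forall>i<k. \<forall>j\<le>i. \<forall>v. br v (x i) \<bullet> x j = 0)"
    using Suc_leD by blast
  then have x: "\<And>i j. i < k \<Longrightarrow> j < k \<Longrightarrow> x i \<bullet> x j = (if i = j then 1 else 0)"
    and ideal: "\<And>v y j. (\<And>j. j < k \<Longrightarrow> y \<bullet> x j = 0) \<Longrightarrow> j < k \<Longrightarrow> br v y \<bullet> x j = 0"
    and tri: "\<And>i j v. i < k \<Longrightarrow> j \<le> i \<Longrightarrow> br v (x i) \<bullet> x j = 0"
    by blast+
  define I where "I = {y. \<forall>j<k. y \<bullet> x j = 0}"
  define J where "J = {br v y | v y. y \<in> I}"
  have I: "subspace I"
    by (auto simp: I_def subspace_def inner_add_left)
  have "J \<subseteq> I"
    using ideal by (auto simp: I_def J_def)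
  then have JI: "span J \<subseteq> span I"
    by (rule span_mono)
  \<comment> \<open>Otherwise I would lie in every term of the lower central series and be zero,
    although fewer vectors than the dimension have been chosen.\<close>
  have "span J \<noteq> span I"
  proof
    assume eq: "span J = span I"
    have "I \<subseteq> lower_central UNIV br l" for l
    proof (induction l)
      case (Suc l)
      have "I \<subseteq> span J" using eq span_superset[of I] by simp
      also have "\<dots> \<subseteq> lower_central UNIV br (Suc l)"
        using Suc.IH by (auto simp: J_def intro!: span_mono)
      finally show ?case .
    qed simp
    then have "I \<subseteq> {0}" using nil unfolding nilpotent_lie_def by metis
    moreover have "dim (x ` {..<k}) < DIM('v)"
      using dim_le_card'[of "x ` {..<k}"] card_image_le[of "{..<k}" x] Suc.prems by simp
    then obtain y where "y \<noteq> 0" "\<And>z. z \<in> span (x ` {..<k}) \<Longrightarrow> orthogonal y z"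
      using orthogonal_to_subspace_exists by metis
    then have "y \<in> I" "y \<noteq> 0"
      by (auto simp: I_def orthogonal_def span_base)
    ultimately show False by auto
  qed
  with JI obtain u where u: "u \<noteq> 0" "u \<in> span I" "\<And>y. y \<in> span J \<Longrightarrow> orthogonal u y"
    using orthogonal_to_subspace_exists_gen[of J I] by (metis psubsetI)
  define w where "w = u /\<^sub>R norm u"
  have w: "w \<bullet> w = 1"
    using u(1) by (simp add: w_def field_simps flip: power2_norm_eq_inner power2_eq_square)
  have wI: "w \<in> I"
    using u(2) span_minimal[OF subset_refl I] by (auto simp: w_def intro!: subspace_scale[OF I])
  have wJ: "br v y \<bullet> w = 0" if "y \<in> I" for v y
    using u(3)[of "br v y"] that
    by (auto simp: w_def orthogonal_def J_def inner_commute intro!: span_base)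
  show ?case
  proof (intro exI[of _ "x(k := w)"] conjI allI impI)
    fix i j assume "i < Suc k" "j < Suc k"
    then show "(x(k := w)) i \<bullet> (x(k := w)) j = (if i = j then 1 else 0)"
      using x w wI by (auto simp: less_Suc_eq I_def inner_commute)
  next
    fix v y j assume y: "\<forall>j<Suc k. y \<bullet> (x(k := w)) j = 0" and j: "j < Suc k"
    have yx: "y \<bullet> x i = 0" if "i < k" for i
      using y[rule_format, of i] that by simp
    then have "y \<in> I"
      by (simp add: I_def)
    then show "br v y \<bullet> (x(k := w)) j = 0"
      using ideal[of y j v] yx wJ j by (cases "j = k") auto
  next
    fix i j v assume "i < Suc k" "j \<le> i"
    then show "br v ((x(k := w)) i) \<bullet> (x(k := w)) j = 0"
      using tri[of i j v] wJ[OF wI, of v] ideal[of w j v] wI by (cases "i = k"; cases "j = k") (auto simp: I_def)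
  qed
qed

section \<open>Orthonormal quintuples and plane rotations\<close>

definition orthonormal5 :: "'v::real_inner \<Rightarrow> 'v \<Rightarrow> 'v \<Rightarrow> 'v \<Rightarrow> 'v \<Rightarrow> bool" where
  "orthonormal5 x1 x2 x3 x4 x5 \<longleftrightarrow>
     x1 \<bullet> x1 = 1 \<and> x2 \<bullet> x2 = 1 \<and> x3 \<bullet> x3 = 1 \<and> x4 \<bullet> x4 = 1 \<and> x5 \<bullet> x5 = 1 \<and>
     x1 \<bullet> x2 = 0 \<and> x1 \<bullet> x3 = 0 \<and> x1 \<bullet> x4 = 0 \<and> x1 \<bullet> x5 = 0 \<and> x2 \<bullet> x3 = 0 \<and>
     x2 \<bullet> x4 = 0 \<and> x2 \<bullet> x5 = 0 \<and> x3 \<bullet> x4 = 0 \<and> x3 \<bullet> x5 = 0 \<and> x4 \<bullet> x5 = 0"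

lemma orthonormal5_vector:
  assumes "orthonormal5 x1 x2 x3 x4 x5"
  shows "\<And>i j. (vector [x1, x2, x3, x4, x5] :: 'v::real_inner ^ 5) $ i
    \<bullet> (vector [x1, x2, x3, x4, x5] :: 'v ^ 5) $ j = (if i = j then 1 else 0)"
proof -
  have "\<forall>i j. (vector [x1, x2, x3, x4, x5] :: 'v::real_inner ^ 5) $ i
    \<bullet> (vector [x1, x2, x3, x4, x5] :: 'v ^ 5) $ j = (if i = j then 1 else 0)"
    using assms unfolding orthonormal5_def forall_5 by (simp add: inner_commute)
  then show "\<And>i j. ?thesis i j" by blast
qed

text \<open>The rotation that turns (p, q) onto the first axis: the second rotated component is c q
  - s p. It is applied to the coefficients of two brackets with x_4.\<close>

lemma rotation_exists:
  fixes p q :: real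
  obtains c s where "c * c + s * s = 1" "c * q = s * p"
proof (cases "p = 0 \<and> q = 0")
  case True
  then show ?thesis using that[of 1 0] by simp
next
  case False
  define r where "r = sqrt (p * p + q * q)"
  have "r > 0" "r * r = p * p + q * q"
    using False by (auto simp: r_def sum_squares_gt_zero_iff)
  then have "p / r * (p / r) + q / r * (q / r) = 1"
    using False by (simp add: add_divide_distrib[symmetric] sum_squares_eq_zero_iff)
  then show ?thesis
    using that[of "p / r" "q / r"] by simp
qed

text \<open>The Lie algebra in coordinates of an orthonormal frame: the metric is the standard inner
  product, and all geometry sits in the bracket.\<close>

locale real5_bracket =
  fixes br :: "real ^ 5 \<Rightarrow> real ^ 5 \<Rightarrow> real ^ 5"
  assumes bilinear: "bilinear br"
    and alternating: "\<And>v. br v v = 0"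
    and jacobi: "\<And>u v w. br u (br v w) + br v (br w u) + br w (br u v) = 0"
    and nilpotent: "nilpotent_lie UNIV br"
begin

lemmas br_simps = bilinear_ladd[OF bilinear] bilinear_radd[OF bilinear]
  bilinear_lmul[OF bilinear] bilinear_rmul[OF bilinear]
  bilinear_lsub[OF bilinear] bilinear_rsub[OF bilinear]
  bilinear_lneg[OF bilinear] bilinear_rneg[OF bilinear]
  bilinear_lzero[OF bilinear] bilinear_rzero[OF bilinear] alternating

lemma br_anti: "br u v = - br v u"
proof -
  have "br (u + v) (u + v) = br u v + br v u"
    by (simp add: bilinear_ladd[OF bilinear] bilinear_radd[OF bilinear] alternating[of u] alternating[of v])
  then have "br u v + br v u = 0" by (simp add: alternating)
  then show ?thesis by (rule eq_neg_iff_add_eq_0[THEN iffD2])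
qed

text \<open>The brackets of a basis adapted to a flag of ideals; \<open>b\<^sub>i\<^sub>j\<close> and \<open>c\<^sub>i\<^sub>j\<close> are the components of \<open>[x\<^sub>i, x\<^sub>j]\<close>
  along \<open>x\<^sub>4\<close> and \<open>x\<^sub>5\<close>, and \<open>g\<^sub>i\<close> is that of \<open>[x\<^sub>i, x\<^sub>4]\<close> along \<open>x\<^sub>5\<close>.\<close>

definition adapted where
  "adapted x1 x2 x3 x4 x5 a b12 b13 b23 c12 c13 c23 g1 g2 g3 \<longleftrightarrow>
     orthonormal5 x1 x2 x3 x4 x5 \<and>
     br x1 x2 = a *\<^sub>R x3 + b12 *\<^sub>R x4 + c12 *\<^sub>R x5 \<and>
     br x1 x3 = b13 *\<^sub>R x4 + c13 *\<^sub>R x5 \<and> br x2 x3 = b23 *\<^sub>R x4 + c23 *\<^sub>R x5 \<and>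
     br x1 x4 = g1 *\<^sub>R x5 \<and> br x2 x4 = g2 *\<^sub>R x5 \<and> br x3 x4 = g3 *\<^sub>R x5 \<and>
     br x1 x5 = 0 \<and> br x2 x5 = 0 \<and> br x3 x5 = 0 \<and> br x4 x5 = 0"

section \<open>Reduction of adapted bases to the normal form\<close>

lemma adapted_orthonormal:
  "adapted x1 x2 x3 x4 x5 a b12 b13 b23 c12 c13 c23 g1 g2 g3 \<Longrightarrow> orthonormal5 x1 x2 x3 x4 x5"
  by (simp add: adapted_def)

lemma adapted_br:
  assumes "adapted x1 x2 x3 x4 x5 a b12 b13 b23 c12 c13 c23 g1 g2 g3"
  shows "br x1 x2 = a *\<^sub>R x3 + b12 *\<^sub>R x4 + c12 *\<^sub>R x5" "br x1 x3 = b13 *\<^sub>R x4 + c13 *\<^sub>R x5"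
    "br x2 x3 = b23 *\<^sub>R x4 + c23 *\<^sub>R x5" "br x1 x4 = g1 *\<^sub>R x5" "br x2 x4 = g2 *\<^sub>R x5"
    "br x3 x4 = g3 *\<^sub>R x5" "br x1 x5 = 0" "br x2 x5 = 0" "br x3 x5 = 0" "br x4 x5 = 0"
    "br x2 x1 = - (a *\<^sub>R x3 + b12 *\<^sub>R x4 + c12 *\<^sub>R x5)" "br x3 x1 = - (b13 *\<^sub>R x4 + c13 *\<^sub>R x5)"
    "br x3 x2 = - (b23 *\<^sub>R x4 + c23 *\<^sub>R x5)" "br x4 x1 = - (g1 *\<^sub>R x5)" "br x4 x2 = - (g2 *\<^sub>R x5)"
    "br x4 x3 = - (g3 *\<^sub>R x5)" "br x5 x1 = 0" "br x5 x2 = 0" "br x5 x3 = 0" "br x5 x4 = 0"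
  using assms br_anti[of x2 x1] br_anti[of x3 x1] br_anti[of x3 x2] br_anti[of x4 x1] br_anti[of x4 x2]
    br_anti[of x4 x3] br_anti[of x5 x1] br_anti[of x5 x2] br_anti[of x5 x3] br_anti[of x5 x4]
  by (simp_all add: adapted_def)

text \<open>By triangularity, the bracket of two basis vectors has components only along vectors of
  larger index than both, which leaves 3 + 2 * 2 + 3 = 10 constants.\<close>

lemma adapted_exists:
  obtains x1 x2 x3 x4 x5 a b12 b13 b23 c12 c13 c23 g1 g2 g3
  where "adapted x1 x2 x3 x4 x5 a b12 b13 b23 c12 c13 c23 g1 g2 g3"
proof -
  obtain x :: "nat \<Rightarrow> real ^ 5"
    where on: "\<forall>i<5. \<forall>j<5. x i \<bullet> x j = (if i = j then 1 else 0)"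
      and tri: "\<And>i j v. i < 5 \<Longrightarrow> j \<le> i \<Longrightarrow> br v (x i) \<bullet> x j = 0"
    using nilpotent_adapted_basis[OF nilpotent, of 5] by auto
  have on5: "orthonormal5 (x 0) (x 1) (x 2) (x 3) (x 4)"
    using on by (simp add: orthonormal5_def)
  have exp: "v = (v \<bullet> x 0) *\<^sub>R x 0 + (v \<bullet> x 1) *\<^sub>R x 1 + (v \<bullet> x 2) *\<^sub>R x 2 + (v \<bullet> x 3) *\<^sub>R x 3 + (v \<bullet> x 4) *\<^sub>R x 4" for v
    using orthonormal_expansion_5[OF orthonormal5_vector[OF on5], of v] by (simp add: sum_5 add.assoc)
  have "adapted (x 0) (x 1) (x 2) (x 3) (x 4) (br (x 0) (x 1) \<bullet> x 2)
    (br (x 0) (x 1) \<bullet> x 3) (br (x 0) (x 2) \<bullet> x 3) (br (x 1) (x 2) \<bullet> x 3)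
    (br (x 0) (x 1) \<bullet> x 4) (br (x 0) (x 2) \<bullet> x 4) (br (x 1) (x 2) \<bullet> x 4)
    (br (x 0) (x 3) \<bullet> x 4) (br (x 1) (x 3) \<bullet> x 4) (br (x 2) (x 3) \<bullet> x 4)"
    unfolding adapted_def
    by (rule conjI, rule on5)
      ((rule conjI)?, rule trans[OF exp], simp add: tri)+
  then show ?thesis by (rule that)
qed

text \<open>The first identity settles when x_2 and x_3 may be rotated; the second gives
  \<open>b23 * g1 = 0\<close> once the other two brackets with x_4 vanish.\<close>

lemma adapted_jacobi:
  assumes ad: "adapted x1 x2 x3 x4 x5 a b12 b13 b23 c12 c13 c23 g1 g2 g3"
  shows "a * g3 = 0" "b23 * g1 - b13 * g2 + b12 * g3 = 0"
proof -
  have "x5 \<noteq> 0" using ad by (auto simp: adapted_def orthonormal5_def)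
  then show "a * g3 = 0"
    using jacobi[of x1 x2 x4] by (simp add: adapted_br[OF ad] br_simps)
  have "(b23 * g1 - b13 * g2 + b12 * g3) *\<^sub>R x5 = 0"
    using jacobi[of x1 x2 x3] by (simp add: adapted_br[OF ad] br_simps algebra_simps)
  then show "b23 * g1 - b13 * g2 + b12 * g3 = 0"
    using \<open>x5 \<noteq> 0\<close> by simp
qed

text \<open>With \<open>a = 0\<close> no bracket has an x_3 component, so any orthonormal basis of
  the plane of x_2 and x_3 is still adapted. The bracket of the rotated pair is unchanged, since the
  determinant is 1.\<close>

lemma adapted_rotate_23:
  assumes ad: "adapted x1 x2 x3 x4 x5 0 b12 b13 b23 c12 c13 c23 g1 g2 g3"
  obtains y2 y3 b12' b13' b23' c12' c13' c23' g2'
  where "adapted x1 y2 y3 x4 x5 0 b12' b13' b23' c12' c13' c23' g1 g2' 0"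
proof -
  obtain c s where cs: "c * c + s * s = 1" "c * g3 = s * g2"
    by (rule rotation_exists)
  \<comment> \<open>As a rewrite rule, this reduces polynomials in \<open>c\<close> and
    \<open>s\<close> modulo the circle relation.\<close>
  have cc: "c * c = 1 - s * s"
    using cs(1) by simp
  have "adapted x1 (c *\<^sub>R x2 + s *\<^sub>R x3) (- s *\<^sub>R x2 + c *\<^sub>R x3) x4 x5 0
    (c * b12 + s * b13) (c * b13 - s * b12) b23 (c * c12 + s * c13) (c * c13 - s * c12) c23
    g1 (c * g2 + s * g3) 0"
    unfolding adapted_def
    using adapted_orthonormal[OF ad] cs(2)
    by (simp add: cc orthonormal5_def adapted_br[OF ad] br_simps inner_add_left inner_add_right inner_commute algebra_simps)
  then show ?thesis by (rule that)
qed

lemma adapted_rotate_12: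
  assumes ad: "adapted x1 x2 x3 x4 x5 a b12 b13 b23 c12 c13 c23 g1 g2 0"
  obtains y1 y2 b13' b23' c13' c23' g1'
  where "adapted y1 y2 x3 x4 x5 a b12 b13' b23' c12 c13' c23' g1' 0 0"
proof -
  obtain c s where cs: "c * c + s * s = 1" "c * g2 = s * g1"
    by (rule rotation_exists)
  have cc: "c * c = 1 - s * s"
    using cs(1) by simp
  have "adapted (c *\<^sub>R x1 + s *\<^sub>R x2) (- s *\<^sub>R x1 + c *\<^sub>R x2) x3 x4 x5 a
    b12 (c * b13 + s * b23) (c * b23 - s * b13) c12 (c * c13 + s * c23) (c * c23 - s * c13)
    (c * g1 + s * g2) 0 0"
    unfolding adapted_def
    using adapted_orthonormal[OF ad] cs(2)
    by (simp add: cc orthonormal5_def adapted_br[OF ad] br_simps inner_add_left inner_add_right inner_commute algebra_simps)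
  then show ?thesis by (rule that)
qed

text \<open>Either \<open>a = 0\<close> and a rotation of x_2, x_3 removes \<open>g3\<close>, or the
  Jacobi identity has removed it. A rotation of x_1, x_2 then removes \<open>g2\<close>; it is
  always admissible, because no bracket has a component along x_1 or x_2.\<close>

lemma adapted_normal_form:
  obtains x1 x2 x3 x4 x5 a b12 b13 b23 c12 c13 c23 g
  where "adapted x1 x2 x3 x4 x5 a b12 b13 b23 c12 c13 c23 g 0 0"
proof -
  obtain x1 x2 x3 x4 x5 a b12 b13 b23 c12 c13 c23 g1 g2 g3
    where ad: "adapted x1 x2 x3 x4 x5 a b12 b13 b23 c12 c13 c23 g1 g2 g3"
    by (rule adapted_exists)
  obtain y2 y3 b12' b13' b23' c12' c13' c23' g2'
    where "adapted x1 y2 y3 x4 x5 a b12' b13' b23' c12' c13' c23' g1 g2' 0"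
  proof (cases "a = 0")
    case True
    then show ?thesis using ad that by (metis adapted_rotate_23)
  next
    case False
    then have "g3 = 0" using adapted_jacobi(1)[OF ad] by simp
    then show ?thesis using ad that by blast
  qed
  then show ?thesis
    using that adapted_rotate_12 by metis
qed

text \<open>In an adapted basis ad v is strictly triangular, so all its diagonal entries
  vanish.\<close>

lemma trace_ad_eq_0: "(\<Sum>m\<in>UNIV. br v (axis m 1) \<bullet> axis m 1) = 0"
proof -
  obtain x :: "nat \<Rightarrow> real ^ 5"
    where on: "\<forall>i<5. \<forall>j<5. x i \<bullet> x j = (if i = j then 1 else 0)"
      and tri: "\<And>i j v. i < 5 \<Longrightarrow> j \<le> i \<Longrightarrow> br v (x i) \<bullet> x j = 0"
    using nilpotent_adapted_basis[OF nilpotent, of 5] by auto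
  have on5: "orthonormal5 (x 0) (x 1) (x 2) (x 3) (x 4)"
    using on by (simp add: orthonormal5_def)
  have "bilinear (\<lambda>u w. br v u \<bullet> w)"
    by (auto simp: bilinear_def br_simps inner_add_left inner_add_right intro!: linearI)
  from bilinear_contraction_5[OF orthonormal5_vector[OF on5] this] show ?thesis
    by (simp add: sum_5 tri)
qed

lemma adapted_lie_param:
  assumes ad: "adapted x1 x2 x3 x4 x5 a b12 b13 b23 c12 c13 c23 g 0 0"
  shows "\<exists>F. lie_param (tri_bracket a b12 b13 b23 c12 c13 c23 g) UNIV br F"
proof -
  let ?F = "\<lambda>y :: real ^ 5. y $ 1 *\<^sub>R x1 + y $ 2 *\<^sub>R x2 + y $ 3 *\<^sub>R x3 + y $ 4 *\<^sub>R x4 + y $ 5 *\<^sub>R x5"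
  have "lie_param (tri_bracket a b12 b13 b23 c12 c13 c23 g) UNIV br ?F"
  proof (rule lie_param_real5)
    show "linear ?F"
      by (rule linearI) (simp_all add: algebra_simps)
    show "y = 0" if "?F y = 0" for y
    proof -
      have "?F y \<bullet> x1 = 0" "?F y \<bullet> x2 = 0" "?F y \<bullet> x3 = 0" "?F y \<bullet> x4 = 0" "?F y \<bullet> x5 = 0"
        using that by simp_all
      then have "y $ 1 = 0" "y $ 2 = 0" "y $ 3 = 0" "y $ 4 = 0" "y $ 5 = 0"
        using ad by (simp_all add: adapted_def orthonormal5_def inner_add_left inner_add_right inner_commute)
      then show ?thesis by (simp add: vec_eq_5)
    qed
    show "?F (tri_bracket a b12 b13 b23 c12 c13 c23 g y z) = br (?F y) (?F z)" for y z
      by (simp add: adapted_br[OF ad] tri_bracket_def wedge_def br_simps algebra_simps)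
  qed
  then show ?thesis by blast
qed

text \<open>Contraction of the trilinear expression in both slots makes the Dirac operator independent of
  the orthonormal basis; on an adapted basis only the terms with three distinct indices survive.\<close>

lemma adapted_dirac:
  fixes E :: "real ^ 5 \<Rightarrow> 'w::real_vector \<Rightarrow> 'w"
  assumes ad: "adapted x1 x2 x3 x4 x5 a b12 b13 b23 c12 c13 c23 g 0 0"
    and E: "bilinear E"
    and clifford: "\<And>u v w. E u (E v w) + E v (E u w) = (- 2 * (u \<bullet> v)) *\<^sub>R w"
  shows "(\<Sum>m\<in>UNIV. \<Sum>n\<in>UNIV. E (axis m 1) (E (axis n 1) (E (br (axis m 1) (axis n 1)) \<phi>)))
    = 2 *\<^sub>R (a *\<^sub>R E x1 (E x2 (E x3 \<phi>)) + b12 *\<^sub>R E x1 (E x2 (E x4 \<phi>)) + b13 *\<^sub>R E x1 (E x3 (E x4 \<phi>))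
      + b23 *\<^sub>R E x2 (E x3 (E x4 \<phi>)) + c12 *\<^sub>R E x1 (E x2 (E x5 \<phi>)) + c13 *\<^sub>R E x1 (E x3 (E x5 \<phi>))
      + c23 *\<^sub>R E x2 (E x3 (E x5 \<phi>)) + g *\<^sub>R E x1 (E x4 (E x5 \<phi>)))"
proof -
  note E_simps = bilinear_ladd[OF E] bilinear_radd[OF E] bilinear_lmul[OF E] bilinear_rmul[OF E]
    bilinear_lsub[OF E] bilinear_rsub[OF E] bilinear_lneg[OF E] bilinear_rneg[OF E] bilinear_lzero[OF E] bilinear_rzero[OF E]
  define x where "x = (\<lambda>i. (vector [x1, x2, x3, x4, x5] :: (real ^ 5) ^ 5) $ i)"
  have x: "x i \<bullet> x j = (if i = j then 1 else 0)" for i j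
    unfolding x_def by (rule orthonormal5_vector[OF adapted_orthonormal[OF ad]])
  have x_nums: "x 1 = x1" "x 2 = x2" "x 3 = x3" "x 4 = x4" "x 5 = x5"
    by (simp_all add: x_def)
  have "bilinear (\<lambda>v v'. E u (E v (E (br u v') \<phi>)))" for u
    by (auto simp: bilinear_def br_simps E_simps intro!: linearI)
  note c1 = bilinear_contraction_5[OF x this]
  have "bilinear (\<lambda>u u'. E u (E v (E (br u' v) \<phi>)))" for v
    by (auto simp: bilinear_def br_simps E_simps intro!: linearI)
  note c2 = bilinear_contraction_5[OF x this]
  have "(\<Sum>m\<in>UNIV. \<Sum>n\<in>UNIV. E (axis m 1) (E (axis n 1) (E (br (axis m 1) (axis n 1)) \<phi>)))
    = (\<Sum>k\<in>UNIV. \<Sum>m\<in>UNIV. E (axis m 1) (E (x k) (E (br (axis m 1) (x k)) \<phi>)))"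
    unfolding c1 by (rule sum.swap)
  also have "\<dots> = (\<Sum>k\<in>UNIV. \<Sum>l\<in>UNIV. E (x l) (E (x k) (E (br (x l) (x k)) \<phi>)))"
    unfolding c2 ..
  finally have sum: "(\<Sum>m\<in>UNIV. \<Sum>n\<in>UNIV. E (axis m 1) (E (axis n 1) (E (br (axis m 1) (axis n 1)) \<phi>)))
    = (\<Sum>k\<in>UNIV. \<Sum>l\<in>UNIV. E (x l) (E (x k) (E (br (x l) (x k)) \<phi>)))" .
  have anti: "E u (E v w) = - E v (E u w)" if "u \<bullet> v = 0" for u v w
    using clifford[of u v w] that by (simp add: eq_neg_iff_add_eq_0)
  \<comment> \<open>In every surviving term the third factor has a larger index than the first two,
    so sorting only swaps those two, and they are among x_1, ..., x_4. The two orders of a pair then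
    agree, whence the factor 2.\<close>
  have anti': "E x2 (E x1 w) = - E x1 (E x2 w)" "E x3 (E x1 w) = - E x1 (E x3 w)"
    "E x4 (E x1 w) = - E x1 (E x4 w)" "E x3 (E x2 w) = - E x2 (E x3 w)"
    "E x4 (E x2 w) = - E x2 (E x4 w)" "E x4 (E x3 w) = - E x3 (E x4 w)" for w
    using adapted_orthonormal[OF ad] by (auto simp: orthonormal5_def inner_commute intro!: anti)
  show ?thesis
    unfolding sum scaleR_2
    by (simp add: sum_5 x_nums adapted_br[OF ad] br_simps E_simps anti' algebra_simps)
qed

text \<open>If \<open>\<Theta>\<close> kills \<open>\<phi>\<close>, then \<open>\<phi>\<close> is an eigenvector of \<open>Q\<close> with eigenvalue \<open>- N / 2\<close>, whose square must be the
  scalar \<open>Q\<^sup>2\<close>.\<close>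

lemma adapted_dirac_kernel:
  fixes E :: "real ^ 5 \<Rightarrow> 'w::real_vector \<Rightarrow> 'w"
  assumes ad: "adapted x1 x2 x3 x4 x5 a b12 b13 b23 c12 c13 c23 g 0 0"
    and E: "bilinear E"
    and clifford: "\<And>u v w. E u (E v w) + E v (E u w) = (- 2 * (u \<bullet> v)) *\<^sub>R w"
    and dirac: "(\<Sum>m\<in>UNIV. \<Sum>n\<in>UNIV. E (axis m 1) (E (axis n 1) (E (br (axis m 1) (axis n 1)) \<phi>))) = 0"
    and "\<phi> \<noteq> 0"
  shows "(a\<^sup>2 + b12\<^sup>2 + b13\<^sup>2 + b23\<^sup>2 + c12\<^sup>2 + c13\<^sup>2 + c23\<^sup>2 + g\<^sup>2)\<^sup>2
    = 4 * ((b12 * c13 - a * g - c12 * b13)\<^sup>2 + (c12 * b23 - b12 * c23)\<^sup>2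
      + (b13 * c23 - c13 * b23)\<^sup>2 + (b23 * g)\<^sup>2 + (- (c23 * g))\<^sup>2)" (is "?N\<^sup>2 = 4 * ?q")
proof -
  define \<Theta> where "\<Theta> w = a *\<^sub>R E x1 (E x2 (E x3 w)) + b12 *\<^sub>R E x1 (E x2 (E x4 w)) + b13 *\<^sub>R E x1 (E x3 (E x4 w))
      + b23 *\<^sub>R E x2 (E x3 (E x4 w)) + c12 *\<^sub>R E x1 (E x2 (E x5 w)) + c13 *\<^sub>R E x1 (E x3 (E x5 w))
      + c23 *\<^sub>R E x2 (E x3 (E x5 w)) + g *\<^sub>R E x1 (E x4 (E x5 w))" for w
  define Q where "Q w = (b12 * c13 - a * g - c12 * b13) *\<^sub>R E x2 (E x3 (E x4 (E x5 w)))
      + (c12 * b23 - b12 * c23) *\<^sub>R E x1 (E x3 (E x4 (E x5 w)))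
      + (b13 * c23 - c13 * b23) *\<^sub>R E x1 (E x2 (E x4 (E x5 w)))
      + (b23 * g) *\<^sub>R E x1 (E x2 (E x3 (E x5 w))) + (- (c23 * g)) *\<^sub>R E x1 (E x2 (E x3 (E x4 w)))" for w
  have lin: "linear (E u)" for u
    using E by (simp add: bilinear_def)
  have anti: "E u (E v w) = - E v (E u w)" if "u \<bullet> v = 0" for u v w
    using clifford[of u v w] that by (simp add: eq_neg_iff_add_eq_0)
  have sq: "E u (E u w) = - w" if "u \<bullet> u = 1" for u w
  proof -
    have "2 *\<^sub>R (E u (E u w) + w) = 0"
      using clifford[of u u w] that by (simp add: scaleR_2 algebra_simps)
    then show ?thesis by (simp add: eq_neg_iff_add_eq_0)
  qed
  note on = adapted_orthonormal[OF ad, unfolded orthonormal5_def]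
  have lin_Q: "Q (r *\<^sub>R w) = r *\<^sub>R Q w" for r w
    by (simp add: Q_def linear_scale[OF lin] algebra_simps)
  have "\<Theta> (\<Theta> \<phi>) = ?N *\<^sub>R \<phi> + (Q \<phi> + Q \<phi>)"
    by (rule clifford_three_form_square[OF lin lin lin lin lin])
      (use on in \<open>auto simp: \<Theta>_def Q_def inner_commute intro!: sq anti\<close>)
  moreover have "\<Theta> \<phi> = 0"
    using dirac unfolding adapted_dirac[OF ad E clifford] by (simp add: \<Theta>_def)
  moreover have "\<Theta> 0 = 0"
    by (simp add: \<Theta>_def linear_0[OF lin])
  ultimately have "0 = ?N *\<^sub>R \<phi> + (Q \<phi> + Q \<phi>)"
    by metis
  moreover have "2 *\<^sub>R q = (- r) *\<^sub>R w" if "0 = r *\<^sub>R w + (q + q)" for r and q w :: 'w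
    using that by (simp add: scaleR_2 eq_neg_iff_add_eq_0 add.commute)
  ultimately have Q: "2 *\<^sub>R Q \<phi> = (- ?N) *\<^sub>R \<phi>"
    by blast
  then have "Q (2 *\<^sub>R Q \<phi>) = (- ?N) *\<^sub>R Q \<phi>"
    by (simp only: lin_Q)
  then have "2 *\<^sub>R Q (Q \<phi>) = (- ?N) *\<^sub>R Q \<phi>"
    by (simp only: lin_Q)
  then have "2 *\<^sub>R (2 *\<^sub>R Q (Q \<phi>)) = (- ?N) *\<^sub>R (2 *\<^sub>R Q \<phi>)"
    by (simp only: scaleR_left_commute)
  also have "\<dots> = ?N\<^sup>2 *\<^sub>R \<phi>"
    unfolding Q by (simp only: power2_eq_square scaleR_scaleR minus_mult_minus)
  also have "Q (Q \<phi>) = ?q *\<^sub>R \<phi>"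
    by (rule clifford_four_form_square[OF lin lin lin lin lin])
      (use on in \<open>auto simp: Q_def inner_commute intro!: sq anti\<close>)
  finally have "(4 * ?q) *\<^sub>R \<phi> = ?N\<^sup>2 *\<^sub>R \<phi>"
    by simp
  then show ?thesis
    using \<open>\<phi> \<noteq> 0\<close> by (metis scaleR_right_imp_eq)
qed

theorem harmonic_spinor_classification:
  fixes E :: "real ^ 5 \<Rightarrow> 'w::real_vector \<Rightarrow> 'w"
  assumes nonabelian: "\<exists>u v. br u v \<noteq> 0"
    and E: "bilinear E"
    and clifford: "\<And>u v w. E u (E v w) + E v (E u w) = (- 2 * (u \<bullet> v)) *\<^sub>R w"
    and dirac: "(\<Sum>m\<in>UNIV. \<Sum>n\<in>UNIV. E (axis m 1) (E (axis n 1) (E (br (axis m 1) (axis n 1)) \<phi>))) = 0"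
    and "\<phi> \<noteq> 0"
  shows "\<exists>m\<in>{L51, L52, L53, L54, L56}. \<exists>F. lie_param m UNIV br F"
proof -
  obtain x1 x2 x3 x4 x5 a b12 b13 b23 c12 c13 c23 g
    where ad: "adapted x1 x2 x3 x4 x5 a b12 b13 b23 c12 c13 c23 g 0 0"
    by (rule adapted_normal_form)
  obtain F where F: "lie_param (tri_bracket a b12 b13 b23 c12 c13 c23 g) UNIV br F"
    using adapted_lie_param[OF ad] by blast
  have "a\<^sup>2 + b12\<^sup>2 + b13\<^sup>2 + b23\<^sup>2 + c12\<^sup>2 + c13\<^sup>2 + c23\<^sup>2 + g\<^sup>2 \<noteq> 0"
  proof
    assume "a\<^sup>2 + b12\<^sup>2 + b13\<^sup>2 + b23\<^sup>2 + c12\<^sup>2 + c13\<^sup>2 + c23\<^sup>2 + g\<^sup>2 = 0"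
    then have "tri_bracket a b12 b13 b23 c12 c13 c23 g y z = 0" for y z
      by (simp add: add_nonneg_eq_0_iff tri_bracket_def vec_eq_5)
    then have "br (F y) (F z) = 0" for y z
      using F by (metis lie_param_def linear_0)
    then show False
      using nonabelian F unfolding lie_param_def by (metis UNIV_I rangeE)
  qed
  moreover have "b23 * g = 0"
    using adapted_jacobi(2)[OF ad] by simp
  ultimately obtain m F' where "m \<in> {L51, L52, L53, L54, L56}"
    "lie_param m UNIV (tri_bracket a b12 b13 b23 c12 c13 c23 g) F'"
    using tri_bracket_cases adapted_dirac_kernel[OF ad E clifford dirac \<open>\<phi> \<noteq> 0\<close>] by metis
  then show ?thesis
    using lie_param_trans[OF _ F] by blast
qed

end

section \<open>Smooth functions and Clifford representations\<close>

lemma sum_fun_apply: "(\<Sum>i\<in>I. f i) x = (\<Sum>i\<in>I. f i x)"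
  by (induction I rule: infinite_finite_induct) simp_all

text \<open>On an open set the derivative depends only on the values inside, so equality passes to
  derivatives of every order. This is what allows derivative formulas valid only on \<open>S\<close>
  to be substituted.\<close>

lemma Ck_on_cong:
  fixes f h :: "'a::euclidean_space \<Rightarrow> 'b::real_normed_vector"
  assumes "open S" "\<And>x. x \<in> S \<Longrightarrow> f x = h x"
  shows "Ck_on k f S \<longleftrightarrow> Ck_on k h S"
  using assms(2)
proof (induction k arbitrary: f h)
  case 0
  then show ?case by (simp cong: continuous_on_cong)
next
  case (Suc k)
  have imp: "Ck_on (Suc k) h S" if f: "Ck_on (Suc k) f S" and eq: "\<And>x. x \<in> S \<Longrightarrow> f x = h x"
    for f h :: "'a \<Rightarrow> 'b"
  proof -
    have f': "f differentiable_on S" using f by simp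
    then have h': "h differentiable_on S"
      using eq by (metis differentiable_on_def differentiable_transform_within zero_less_one)
    have fd: "frechet_derivative f (at x) = frechet_derivative h (at x)" if "x \<in> S" for x
    proof (rule frechet_derivative_transform_within_open)
      show "f differentiable at x"
        using f' that \<open>open S\<close> by (simp add: differentiable_on_eq_differentiable_at)
    qed (use assms(1) that eq in auto)
    have "Ck_on k (\<lambda>x. frechet_derivative f (at x) b) S \<longleftrightarrow> Ck_on k (\<lambda>x. frechet_derivative h (at x) b) S" for b
      by (rule Suc.IH) (simp add: fd)
    then show ?thesis using f h' by simp
  qed
  show ?case
    using imp[of f h] imp[of h f] Suc.prems by metis
qed

lemma Ck_on_const: "Ck_on k (\<lambda>x. c) S"
  by (induction k arbitrary: c) (simp_all add: frechet_derivative_const)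

lemma Ck_on_lincomb:
  assumes "open S" "Ck_on k f S" "Ck_on k h S"
  shows "Ck_on k (\<lambda>x. c *\<^sub>R f x + d *\<^sub>R h x) S"
  using assms(2,3)
proof (induction k arbitrary: f h)
  case 0
  then show ?case by (auto intro!: continuous_intros)
next
  case (Suc k)
  have diff: "f differentiable at x" "h differentiable at x" if "x \<in> S" for x
    using Suc.prems that \<open>open S\<close> by (auto simp: differentiable_on_eq_differentiable_at)
  have fd: "frechet_derivative (\<lambda>x. c *\<^sub>R f x + d *\<^sub>R h x) (at x) b
      = c *\<^sub>R frechet_derivative f (at x) b + d *\<^sub>R frechet_derivative h (at x) b" if "x \<in> S" for x b
  proof -
    have "((\<lambda>x. c *\<^sub>R f x + d *\<^sub>R h x) has_derivative
        (\<lambda>b. c *\<^sub>R frechet_derivative f (at x) b + d *\<^sub>R frechet_derivative h (at x) b)) (at x)"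
      using diff[OF that] by (auto intro!: derivative_eq_intros simp: frechet_derivative_works)
    from frechet_derivative_at[OF this] show ?thesis by metis
  qed
  have "(\<lambda>x. c *\<^sub>R f x + d *\<^sub>R h x) differentiable_on S"
    using Suc.prems by (auto intro!: derivative_intros)
  moreover have "Ck_on k (\<lambda>x. frechet_derivative (\<lambda>x. c *\<^sub>R f x + d *\<^sub>R h x) (at x) b) S" if "b \<in> Basis" for b
    using Suc.IH[of "\<lambda>x. frechet_derivative f (at x) b" "\<lambda>x. frechet_derivative h (at x) b"] Suc.prems that
    by (subst Ck_on_cong[OF \<open>open S\<close> fd]) auto
  ultimately show ?case by simp
qed

lemma smooth_functions_const: "(\<lambda>x. c) \<in> smooth_functions \<A>"
  by (auto simp: smooth_functions_def smooth_on_def comp_def Ck_on_const)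

lemma smooth_functions_lincomb:
  assumes "smooth_atlas \<A>" "f \<in> smooth_functions \<A>" "h \<in> smooth_functions \<A>"
  shows "c *\<^sub>R f + d *\<^sub>R h \<in> smooth_functions \<A>"
proof -
  have "smooth_on ((c *\<^sub>R f + d *\<^sub>R h) \<circ> inv_into U \<psi>) (\<psi> ` U)" if "(U, \<psi>) \<in> \<A>" for U \<psi>
  proof -
    have "open (\<psi> ` U)" using assms(1) that by (auto simp: smooth_atlas_def)
    moreover have "Ck_on k (f \<circ> inv_into U \<psi>) (\<psi> ` U)" "Ck_on k (h \<circ> inv_into U \<psi>) (\<psi> ` U)" for k
      using assms(2,3) that unfolding smooth_functions_def smooth_on_def by blast+
    ultimately show ?thesis
      using Ck_on_lincomb[of "\<psi> ` U" _ "f \<circ> inv_into U \<psi>" "h \<circ> inv_into U \<psi>" c d]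
      by (simp add: smooth_on_def comp_def scaleR_fun_def plus_fun_def)
  qed
  then show ?thesis by (auto simp: smooth_functions_def)
qed

lemma vector_fields_lincomb:
  assumes "smooth_atlas \<A>" "X \<in> vector_fields \<A>" "Y \<in> vector_fields \<A>"
  shows "c *\<^sub>R X + d *\<^sub>R Y \<in> vector_fields \<A>"
  using assms(2,3) smooth_functions_lincomb[OF assms(1)]
  by (auto simp: vector_fields_def plus_fun_def times_fun_def scaleR_fun_def fun_eq_iff zero_fun_def algebra_simps)

section \<open>Clifford relations in a representation\<close>

lemma clifford_mult_blade:
  assumes "A \<subseteq> {1..n}" "B \<subseteq> {1..n}"
  shows "clifford_mult n (blade A) (blade B) = blade_sign A B *\<^sub>R blade ((A - B) \<union> (B - A))"
proof -
  have "clifford_mult n (blade A) (blade B)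
    = (\<Sum>A'\<in>Pow {1..n}. if A' = A then \<Sum>B'\<in>Pow {1..n}. if B' = B then
        blade_sign A' B' *\<^sub>R blade ((A' - B') \<union> (B' - A')) else 0 else 0)"
    unfolding clifford_mult_def
    by (rule sum.cong[OF refl], split if_split, intro conjI impI,
        rule sum.cong[OF refl], simp add: fun_cong[OF blade_def],
        rule sum.neutral, simp add: fun_cong[OF blade_def])
  also have "\<dots> = blade_sign A B *\<^sub>R blade ((A - B) \<union> (B - A))"
    using assms by simp
  finally show ?thesis .
qed

lemma blade_in_clifford_algebra: "A \<subseteq> {1..n} \<Longrightarrow> blade A \<in> clifford_algebra n"
  by (auto simp: blade_def clifford_algebra_def)

lemma clifford_rep_linear:
  "clifford_rep n \<rho> \<Longrightarrow> i \<in> {1..n} \<Longrightarrow> linear (\<rho> (blade {i}))"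
  by (simp add: clifford_rep_def blade_in_clifford_algebra)

text \<open>Both orders of a product of two generators give the same blade, so only the signs have
  to be compared. From here on the blade signs are replaced by these relations.\<close>

lemma clifford_rep_anticommute:
  assumes \<rho>: "clifford_rep n \<rho>" and ij: "i \<in> {1..n}" "j \<in> {1..n}"
  shows "\<rho> (blade {i}) (\<rho> (blade {j}) w) + \<rho> (blade {j}) (\<rho> (blade {i}) w) = (if i = j then - 2 else 0) *\<^sub>R w"
proof -
  have prod: "\<rho> (blade {k}) (\<rho> (blade {l}) w) = blade_sign {k} {l} *\<^sub>R \<rho> (blade (({k} - {l}) \<union> ({l} - {k}))) w"
    if "k \<in> {1..n}" "l \<in> {1..n}" for k l
  proof -
    have "\<rho> (clifford_mult n (blade {k}) (blade {l})) = \<rho> (blade {k}) \<circ> \<rho> (blade {l})"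
      using \<rho> that by (simp add: clifford_rep_def blade_in_clifford_algebra)
    moreover have "\<rho> (blade_sign {k} {l} *\<^sub>R blade (({k} - {l}) \<union> ({l} - {k})))
        = blade_sign {k} {l} *\<^sub>R \<rho> (blade (({k} - {l}) \<union> ({l} - {k})))"
      using \<rho> that by (auto simp: clifford_rep_def intro!: blade_in_clifford_algebra)
    ultimately show ?thesis
      using that by (simp add: clifford_mult_blade scaleR_fun_def fun_eq_iff)
  qed
  \<comment> \<open>The inequality is weak: the pair with \<open>l = k\<close> counts and produces
    the sign of a square.\<close>
  have pairs: "{(k', l'). k' \<in> {k} \<and> l' \<in> {l} \<and> l' \<le> k'} = (if l \<le> k then {(k, l)} else {})" for k l :: nat
    by auto
  have sign: "blade_sign {k} {l} = (if l \<le> k then - 1 else 1)" for k l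
    unfolding blade_sign_def pairs by simp
  show ?thesis
  proof (cases "i = j")
    case True
    have "\<rho> (blade {}) = id" using \<rho> by (simp add: clifford_rep_def)
    moreover have "(- 2) *\<^sub>R w = - w - w"
      unfolding scaleR_minus_left scaleR_2 by simp
    ultimately show ?thesis using prod[OF ij] True by (simp add: sign)
  next
    case False
    then have "{j} - {i} \<union> ({i} - {j}) = {i} - {j} \<union> ({j} - {i})" by auto
    then show ?thesis
      using prod[OF ij] prod[OF ij(2,1)] False by (auto simp: sign Un_commute)
  qed
qed

text \<open>Matches the index type with the frame numbering 1, ..., 5. The numeral 5 of the index
  type is its zero, so it is sent to 5 as the remaining case.\<close>

definition idx5 :: "5 \<Rightarrow> nat" where
  "idx5 m = (if m = 1 then 1 else if m = 2 then 2 else if m = 3 then 3 else if m = 4 then 4 else 5)"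

lemma idx5_simps [simp]: "idx5 1 = 1" "idx5 2 = 2" "idx5 3 = 3" "idx5 4 = 4" "idx5 5 = 5"
  by (simp_all add: idx5_def)

lemma idx5_range [simp]: "idx5 m \<in> {1..5}"
  by (simp add: idx5_def)

lemma idx5_eq_iff [simp]: "idx5 m = idx5 n \<longleftrightarrow> m = n"
  using exhaust_5[of m] exhaust_5[of n] by auto

lemma atLeastAtMost_1_5: "{1..5::nat} = {1, 2, 3, 4, 5}"
  by auto

lemma sum_idx5: "(\<Sum>i\<in>{1..5}. f i) = (\<Sum>m\<in>UNIV. f (idx5 m))"
  unfolding sum_5 atLeastAtMost_1_5 by simp

text \<open>Turns the sum over j < k in the spin connection into a contraction over all pairs of
  indices.\<close>

lemma sum_less_idx5:
  fixes F :: "nat \<Rightarrow> nat \<Rightarrow> 'w::real_vector"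
  assumes "\<And>j k. j \<in> {1..5} \<Longrightarrow> k \<in> {1..5} \<Longrightarrow> F k j = F j k" "\<And>j. j \<in> {1..5} \<Longrightarrow> F j j = 0"
  shows "2 *\<^sub>R (\<Sum>j\<in>{1..5}. \<Sum>k\<in>{j<..5}. F j k) = (\<Sum>m\<in>UNIV. \<Sum>n\<in>UNIV. F (idx5 m) (idx5 n))"
proof -
  have sets: "{Suc 0<..5} = {2, 3, 4, 5::nat}" "{2<..5} = {3, 4, 5::nat}" "{3<..5} = {4, 5::nat}" "{4<..5} = {5::nat}"
    by auto
  have sym: "F 2 1 = F 1 2" "F 3 1 = F 1 3" "F 4 1 = F 1 4" "F 5 1 = F 1 5" "F 3 2 = F 2 3"
    "F 4 2 = F 2 4" "F 5 2 = F 2 5" "F 4 3 = F 3 4" "F 5 3 = F 3 5" "F 5 4 = F 4 5"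
    "F 1 1 = 0" "F 2 2 = 0" "F 3 3 = 0" "F 4 4 = 0" "F 5 5 = 0"
    using assms by simp_all
  show ?thesis
    unfolding atLeastAtMost_1_5 scaleR_2 using sym by (simp add: sets sum_5 algebra_simps)
qed

text \<open>Clifford multiplication by an arbitrary vector, so that the relations can be used in an
  adapted basis instead of the given frame.\<close>

definition clifford_vec :: "(clifford \<Rightarrow> 'w::real_vector \<Rightarrow> 'w) \<Rightarrow> real ^ 5 \<Rightarrow> 'w \<Rightarrow> 'w" where
  "clifford_vec \<rho> v w = (\<Sum>m\<in>UNIV. v $ m *\<^sub>R \<rho> (blade {idx5 m}) w)"

lemma bilinear_clifford_vec:
  assumes "clifford_rep 5 \<rho>"
  shows "bilinear (clifford_vec \<rho>)"
proof -
  have "linear (\<rho> (blade {idx5 m}))" for m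
    using clifford_rep_linear[OF assms idx5_range] .
  note lin = linear_add[OF this] linear_scale[OF this]
  show ?thesis
    unfolding bilinear_def clifford_vec_def
    by (auto intro!: linearI simp: lin scaleR_add_left scaleR_add_right sum.distrib scaleR_sum_right mult.commute)
qed

lemma clifford_vec_axis: "clifford_vec \<rho> (axis m 1) w = \<rho> (blade {idx5 m}) w"
  by (simp add: clifford_vec_def axis_def if_distrib[of "\<lambda>r. r *\<^sub>R _"] cong: if_cong)

lemma clifford_vec_clifford:
  assumes \<rho>: "clifford_rep 5 \<rho>"
  shows "clifford_vec \<rho> u (clifford_vec \<rho> v w) + clifford_vec \<rho> v (clifford_vec \<rho> u w) = (- 2 * (u \<bullet> v)) *\<^sub>R w"
proof -
  have "linear (\<rho> (blade {idx5 m}))" for m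
    using clifford_rep_linear[OF assms idx5_range] .
  note lin = linear_sum[OF this] linear_scale[OF this]
  have prod: "clifford_vec \<rho> u (clifford_vec \<rho> v w)
      = (\<Sum>m\<in>UNIV. \<Sum>n\<in>UNIV. (u $ m * v $ n) *\<^sub>R \<rho> (blade {idx5 m}) (\<rho> (blade {idx5 n}) w))" for u v
    by (simp add: clifford_vec_def lin scaleR_sum_right)
  have "clifford_vec \<rho> u (clifford_vec \<rho> v w) + clifford_vec \<rho> v (clifford_vec \<rho> u w)
      = (\<Sum>m\<in>UNIV. \<Sum>n\<in>UNIV. (u $ m * v $ n) *\<^sub>R (\<rho> (blade {idx5 m}) (\<rho> (blade {idx5 n}) w)
          + \<rho> (blade {idx5 n}) (\<rho> (blade {idx5 m}) w)))"
    unfolding prod scaleR_add_right sum.distrib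
    by (subst (2) sum.swap) (simp add: mult.commute)
  also have "\<dots> = (\<Sum>m\<in>UNIV. \<Sum>n\<in>UNIV. if m = n then (- 2 * (u $ m * v $ m)) *\<^sub>R w else 0)"
    by (intro sum.cong refl) (simp add: clifford_rep_anticommute[OF \<rho> idx5_range idx5_range])
  also have "\<dots> = (- 2 * (u \<bullet> v)) *\<^sub>R w"
    by (simp add: inner_vec_def sum_distrib_left scaleR_sum_left flip: sum_negf)
  finally show ?thesis .
qed

text \<open>Torsion-freeness and the Clifford relations turn the cubic expression of the Christoffel symbols
  into that of the structure constants; the diagonal terms contribute the traces of \<open>ad\<close>.\<close>

lemma dirac_christoffel_to_structure:
  fixes R :: "'i::finite \<Rightarrow> 'w::real_vector \<Rightarrow> 'w"
  assumes lin: "\<And>m. linear (R m)"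
    and clifford: "\<And>m n w. R m (R n w) + R n (R m w) = (if m = n then - 2 else 0) *\<^sub>R w"
    and antisym: "\<And>m n l. \<Gamma> m n l = - \<Gamma> m l n"
    and torsion: "\<And>m n l. c m n l = \<Gamma> m n l - \<Gamma> n m l"
    and trace: "\<And>l. (\<Sum>m\<in>UNIV. c l m m) = 0"
    and dirac: "(\<Sum>m\<in>UNIV. \<Sum>n\<in>UNIV. \<Sum>l\<in>UNIV. \<Gamma> m n l *\<^sub>R R m (R n (R l \<phi>))) = 0"
  shows "(\<Sum>m\<in>UNIV. \<Sum>n\<in>UNIV. \<Sum>l\<in>UNIV. c m n l *\<^sub>R R m (R n (R l \<phi>))) = 0"
proof -
  \<comment> \<open>Antisymmetry kills \<open>\<Gamma> l m m\<close>, so \<open>c l m m\<close> is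
    \<open>- \<Gamma> m l m\<close>.\<close>
  have diag: "\<Gamma> m m l = c l m m" for m l
    using antisym[of l m m] antisym[of m l m] by (simp add: torsion)
  have swap: "R n (R m w) = - R m (R n w) - (if m = n then 2 else 0) *\<^sub>R w" for m n w
    using clifford[of m n w] by (auto simp: eq_diff_eq eq_neg_iff_add_eq_0 algebra_simps split: if_splits)
  have swap': "\<Gamma> m n l *\<^sub>R R n (R m (R l \<phi>))
      = - (\<Gamma> m n l *\<^sub>R R m (R n (R l \<phi>))) - \<Gamma> m n l *\<^sub>R ((if m = n then 2 else 0) *\<^sub>R R l \<phi>)" for m n l
    by (subst swap) (simp only: scaleR_diff_right scaleR_minus_right)
  have "(\<Sum>m\<in>UNIV. \<Sum>n\<in>UNIV. \<Sum>l\<in>UNIV. c m n l *\<^sub>R R m (R n (R l \<phi>)))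
      = - (\<Sum>m\<in>UNIV. \<Sum>n\<in>UNIV. \<Sum>l\<in>UNIV. \<Gamma> n m l *\<^sub>R R m (R n (R l \<phi>)))"
    using dirac by (simp add: torsion scaleR_diff_left sum_subtractf)
  also have "\<dots> = - (\<Sum>m\<in>UNIV. \<Sum>n\<in>UNIV. \<Sum>l\<in>UNIV. \<Gamma> m n l *\<^sub>R R n (R m (R l \<phi>)))"
    by (subst sum.swap) (rule refl)
  \<comment> \<open>Sorting the first two factors reproduces the vanishing Dirac sum and leaves only
    the terms with \<open>m = n\<close>.\<close>
  also have "\<dots> = (\<Sum>m\<in>UNIV. \<Sum>n\<in>UNIV. \<Sum>l\<in>UNIV. \<Gamma> m n l *\<^sub>R ((if m = n then 2 else 0) *\<^sub>R R l \<phi>))"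
    using dirac by (simp only: swap' sum_subtractf sum_negf) simp
  also have "\<dots> = (\<Sum>m\<in>UNIV. \<Sum>n\<in>UNIV. if m = n then \<Sum>l\<in>UNIV. 2 *\<^sub>R \<Gamma> m m l *\<^sub>R R l \<phi> else 0)"
    by (intro sum.cong refl) (auto simp: mult.commute)
  also have "\<dots> = (\<Sum>m\<in>UNIV. \<Sum>l\<in>UNIV. 2 *\<^sub>R c l m m *\<^sub>R R l \<phi>)"
    by (simp add: diag)
  also have "\<dots> = (\<Sum>l\<in>UNIV. 2 *\<^sub>R (\<Sum>m\<in>UNIV. c l m m) *\<^sub>R R l \<phi>)"
    by (subst sum.swap) (simp add: scaleR_sum_left scaleR_sum_right)
  also have "\<dots> = 0"
    by (simp add: trace)
  finally show ?thesis .
qed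

section \<open>Left-invariant frames\<close>

locale lie_frame =
  fixes \<A> :: "('g::{t2_space, second_countable_topology}, 5) atlas" and G :: "'g monoid"
    and g :: "'g metric_tensor" and con :: "'g vfield \<Rightarrow> 'g vfield \<Rightarrow> 'g vfield" and e :: "nat \<Rightarrow> 'g vfield"
  assumes lie_group: "lie_group \<A> G"
    and metric: "riemannian_metric \<A> g"
    and connection: "levi_civita \<A> g con"
    and frame: "left_invariant_orthonormal_frame \<A> G g 5 e"
begin

abbreviation "SF \<equiv> smooth_functions \<A>"
abbreviation "VF \<equiv> vector_fields \<A>"
abbreviation "L \<equiv> lie_algebra_of \<A> G"

lemma atlas: "smooth_atlas \<A>"
  using lie_group by (simp add: lie_group_def)

lemma group: "group G" and carrier: "carrier G = UNIV"
  using lie_group by (simp_all add: lie_group_def)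

lemma mult_inv_cancel: "(y \<otimes>\<^bsub>G\<^esub> inv\<^bsub>G\<^esub> q) \<otimes>\<^bsub>G\<^esub> q = y"
  by (metis UNIV_I carrier group group.inv_closed group.is_monoid group.l_inv monoid.m_assoc monoid.r_one)

section \<open>Vector fields as derivations, and their brackets\<close>

lemma VF_smooth: "X \<in> VF \<Longrightarrow> f \<in> SF \<Longrightarrow> X f \<in> SF"
  and VF_add: "X \<in> VF \<Longrightarrow> f \<in> SF \<Longrightarrow> h \<in> SF \<Longrightarrow> X (f + h) = X f + X h"
  and VF_scale: "X \<in> VF \<Longrightarrow> f \<in> SF \<Longrightarrow> X (c *\<^sub>R f) = c *\<^sub>R X f"
  and VF_mult: "X \<in> VF \<Longrightarrow> f \<in> SF \<Longrightarrow> h \<in> SF \<Longrightarrow> X (f * h) = f * X h + h * X f"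
  and VF_non_smooth: "X \<in> VF \<Longrightarrow> f \<notin> SF \<Longrightarrow> X f = 0"
  by (auto simp: vector_fields_def)

lemma SF_diff: "f \<in> SF \<Longrightarrow> h \<in> SF \<Longrightarrow> f - h \<in> SF"
  using smooth_functions_lincomb[OF atlas, of f h 1 "- 1"] by simp

lemma VF_diff: "X \<in> VF \<Longrightarrow> f \<in> SF \<Longrightarrow> h \<in> SF \<Longrightarrow> X (f - h) = X f - X h"
  using VF_add[of X "f - h" h] by (simp add: SF_diff eq_diff_eq)

lemma VF_const: "X \<in> VF \<Longrightarrow> X (\<lambda>x. c) = 0"
proof -
  assume X: "X \<in> VF"
  have one: "(\<lambda>x. 1) \<in> SF" by (rule smooth_functions_const)
  have "(\<lambda>x. 1) * (\<lambda>x. 1) = (\<lambda>x :: 'g. 1 :: real)" by (simp add: fun_eq_iff)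
  then have "X (\<lambda>x. 1) = (\<lambda>x. 1) * X (\<lambda>x. 1) + (\<lambda>x. 1) * X (\<lambda>x. 1)"
    using VF_mult[OF X one one] by (simp only:)
  then have "X (\<lambda>x. 1) = 0"
    by (simp add: fun_eq_iff)
  moreover have "(\<lambda>x. c) = c *\<^sub>R (\<lambda>x :: 'g. 1)" by (simp add: fun_eq_iff scaleR_fun_def)
  ultimately show ?thesis using VF_scale[OF X one, of c] by simp
qed

lemma VF_0_arg: "X \<in> VF \<Longrightarrow> X 0 = 0"
  using VF_const[of X 0] by (simp add: zero_fun_def)

lemma VF_subspace: "subspace VF"
proof (rule subspaceI)
  show "0 \<in> VF" by (auto simp: vector_fields_def zero_fun_def smooth_functions_const fun_eq_iff scaleR_fun_def)
qed (use vector_fields_lincomb[OF atlas, of _ _ 1 1] vector_fields_lincomb[OF atlas, of _ _ _ 0] in simp_all)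

lemma L_VF: "X \<in> L \<Longrightarrow> X \<in> VF"
  by (simp add: lie_algebra_of_def)

lemma L_invariant: "X \<in> L \<Longrightarrow> f \<in> SF \<Longrightarrow> X (\<lambda>x. f (a \<otimes>\<^bsub>G\<^esub> x)) y = X f (a \<otimes>\<^bsub>G\<^esub> y)"
  by (simp add: lie_algebra_of_def)

lemma L_subspace: "subspace L"
proof (rule subspaceI)
  show "0 \<in> L" using subspace_0[OF VF_subspace] by (simp add: lie_algebra_of_def fun_eq_iff)
  show "X + Y \<in> L" if "X \<in> L" "Y \<in> L" for X Y
    using that subspace_add[OF VF_subspace] by (simp add: lie_algebra_of_def fun_eq_iff)
  show "c *\<^sub>R X \<in> L" if "X \<in> L" for X c
    using that subspace_scale[OF VF_subspace] by (simp add: lie_algebra_of_def fun_eq_iff scaleR_fun_def)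
qed

text \<open>Torsion-freeness writes the bracket as a difference of two vector fields, which replaces
  a check of the product rule.\<close>

lemma bracket_VF:
  assumes "X \<in> VF" "Y \<in> VF"
  shows "vf_bracket X Y \<in> VF"
proof -
  have "con X Y \<in> VF" "con Y X \<in> VF" "con X Y - con Y X = vf_bracket X Y"
    using connection assms unfolding levi_civita_def by blast+
  moreover from this have "con X Y - con Y X \<in> VF"
    by (intro subspace_diff[OF VF_subspace])
  ultimately show ?thesis by (simp only:)
qed

lemma bracket_L:
  assumes "X \<in> L" "Y \<in> L"
  shows "vf_bracket X Y \<in> L"
proof -
  have *: "X (Y (\<lambda>x. f (a \<otimes>\<^bsub>G\<^esub> x))) = (\<lambda>x. X (Y f) (a \<otimes>\<^bsub>G\<^esub> x))"
    if "X \<in> L" "Y \<in> L" "f \<in> SF" for X Y f a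
  proof -
    have "Y (\<lambda>x. f (a \<otimes>\<^bsub>G\<^esub> x)) = (\<lambda>x. Y f (a \<otimes>\<^bsub>G\<^esub> x))"
      by (rule ext) (rule L_invariant[OF that(2,3)])
    then show ?thesis
      by (simp only:) (rule ext, rule L_invariant[OF that(1) VF_smooth[OF L_VF[OF that(2)] that(3)]])
  qed
  have "vf_bracket X Y (\<lambda>x. f (a \<otimes>\<^bsub>G\<^esub> x)) = (\<lambda>x. vf_bracket X Y f (a \<otimes>\<^bsub>G\<^esub> x))" if "f \<in> SF" for f a
    by (simp add: vf_bracket_def *[OF assms that] *[OF assms(2,1) that] fun_eq_iff)
  then show ?thesis
    using bracket_VF[OF assms[THEN L_VF]] by (simp add: lie_algebra_of_def)
qed

text \<open>Identities between brackets are equalities at all functions, so each of them has a case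
  for functions that are not smooth, where vector fields are 0 by convention.\<close>

lemma bracket_non_smooth:
  assumes "X \<in> VF" "Y \<in> VF" "f \<notin> SF"
  shows "vf_bracket X Y f = 0"
  by (simp only: vf_bracket_def VF_non_smooth[OF assms(1,3)] VF_non_smooth[OF assms(2,3)]
    VF_0_arg[OF assms(1)] VF_0_arg[OF assms(2)] diff_self)

lemma bracket_add_left:
  assumes "X \<in> VF" "X' \<in> VF" "Y \<in> VF"
  shows "vf_bracket (X + X') Y = vf_bracket X Y + vf_bracket X' Y"
proof
  fix f
  show "vf_bracket (X + X') Y f = (vf_bracket X Y + vf_bracket X' Y) f"
  proof (cases "f \<in> SF")
    case True
    have "Y (X f + X' f) = Y (X f) + Y (X' f)"
      by (rule VF_add[OF assms(3) VF_smooth[OF assms(1) True] VF_smooth[OF assms(2) True]])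
    then show ?thesis by (simp add: vf_bracket_def)
  next
    case False
    then show ?thesis
      using assms subspace_add[OF VF_subspace assms(1,2)] by (simp add: bracket_non_smooth)
  qed
qed

lemma bracket_scale_left:
  assumes "X \<in> VF" "Y \<in> VF"
  shows "vf_bracket (c *\<^sub>R X) Y = c *\<^sub>R vf_bracket X Y"
proof
  fix f
  have *: "(c *\<^sub>R Z) h = c *\<^sub>R Z h" for Z :: "'g vfield" and h
    by (simp add: scaleR_fun_def)
  show "vf_bracket (c *\<^sub>R X) Y f = (c *\<^sub>R vf_bracket X Y) f"
  proof (cases "f \<in> SF")
    case True
    have "Y (c *\<^sub>R X f) = c *\<^sub>R Y (X f)"
      by (rule VF_scale[OF assms(2) VF_smooth[OF assms(1) True]])
    then show ?thesis by (simp add: vf_bracket_def * scaleR_diff_right)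
  next
    case False
    then show ?thesis
      using assms subspace_scale[OF VF_subspace assms(1)] by (simp add: bracket_non_smooth *)
  qed
qed

lemma bracket_anti: "vf_bracket X Y = - vf_bracket Y X"
  by (simp add: vf_bracket_def fun_eq_iff)

lemma bracket_jacobi:
  assumes "X \<in> VF" "Y \<in> VF" "Z \<in> VF"
  shows "vf_bracket X (vf_bracket Y Z) + vf_bracket Y (vf_bracket Z X) + vf_bracket Z (vf_bracket X Y) = 0"
proof
  fix f
  show "(vf_bracket X (vf_bracket Y Z) + vf_bracket Y (vf_bracket Z X) + vf_bracket Z (vf_bracket X Y)) f = 0 f"
  proof (cases "f \<in> SF")
    case True
    have "U (V (W f) - W (V f)) = U (V (W f)) - U (W (V f))" if "U \<in> VF" "V \<in> VF" "W \<in> VF" for U V W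
      by (rule VF_diff[OF that(1) VF_smooth[OF that(2) VF_smooth[OF that(3) True]]
            VF_smooth[OF that(3) VF_smooth[OF that(2) True]]])
    from this[OF assms(1,2,3)] this[OF assms(2,3,1)] this[OF assms(3,1,2)]
    show ?thesis by (simp add: vf_bracket_def)
  next
    case False
    then show ?thesis using assms by (simp add: bracket_non_smooth bracket_VF)
  qed
qed

section \<open>The metric as a form over the reals\<close>

lemma g_add: "X \<in> VF \<Longrightarrow> Y \<in> VF \<Longrightarrow> Z \<in> VF \<Longrightarrow> g (X + Y) Z = g X Z + g Y Z"
  using metric by (simp add: riemannian_metric_def)

lemma g_sym: "X \<in> VF \<Longrightarrow> Y \<in> VF \<Longrightarrow> g X Y = g Y X"
  using metric by (simp add: riemannian_metric_def)

lemma g_scale: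
  assumes "X \<in> VF" "Y \<in> VF"
  shows "g (c *\<^sub>R X) Y = c *\<^sub>R g X Y"
proof -
  have "c *\<^sub>R X = vf_mult (\<lambda>x. c) X"
    by (simp add: vf_mult_def fun_eq_iff scaleR_fun_def)
  then have "g (c *\<^sub>R X) Y = (\<lambda>x. c) * g X Y"
    using metric assms smooth_functions_const[of c \<A>] by (simp add: riemannian_metric_def)
  then show ?thesis by (simp add: fun_eq_iff scaleR_fun_def)
qed

lemma g_diff: "X \<in> VF \<Longrightarrow> Y \<in> VF \<Longrightarrow> Z \<in> VF \<Longrightarrow> g (X - Y) Z = g X Z - g Y Z"
  using g_add[of "X - Y" Y Z] subspace_diff[OF VF_subspace, of X Y] by (simp add: eq_diff_eq)

lemma g_zero: "Y \<in> VF \<Longrightarrow> g 0 Y = 0"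
  using g_scale[of Y Y 0] by simp

lemma g_sum:
  assumes "finite I" "\<And>i. i \<in> I \<Longrightarrow> X i \<in> VF" "Y \<in> VF"
  shows "g (\<Sum>i\<in>I. c i *\<^sub>R X i) Y = (\<Sum>i\<in>I. c i *\<^sub>R g (X i) Y)"
  using assms(1,2)
proof (induction I)
  case (insert i I)
  have "(\<Sum>i\<in>I. c i *\<^sub>R X i) \<in> VF"
    using insert by (auto intro!: subspace_sum[OF VF_subspace] subspace_scale[OF VF_subspace])
  then have eq: "g (c i *\<^sub>R X i + (\<Sum>i\<in>I. c i *\<^sub>R X i)) Y = c i *\<^sub>R g (X i) Y + g (\<Sum>i\<in>I. c i *\<^sub>R X i) Y"
    using insert.prems assms(3) g_add[of "c i *\<^sub>R X i"] g_scale[of "X i" Y "c i"]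
    by (simp only: subspace_scale[OF VF_subspace] insertI1)
  have IH: "g (\<Sum>i\<in>I. c i *\<^sub>R X i) Y = (\<Sum>i\<in>I. c i *\<^sub>R g (X i) Y)"
    by (rule insert.IH) (use insert.prems in blast)
  show ?case
    by (simp only: sum.insert[OF insert.hyps] eq IH)
qed (simp add: g_zero[OF assms(3)])

section \<open>The Lie algebra in frame coordinates\<close>

definition comb :: "real ^ 5 \<Rightarrow> 'g vfield" where
  "comb k = (\<Sum>m\<in>UNIV. k $ m *\<^sub>R e (idx5 m))"

lemma e_L: "e (idx5 m) \<in> L"
  using frame idx5_range[of m] unfolding left_invariant_orthonormal_frame_def by blast

lemma e_VF: "e (idx5 m) \<in> VF"
  by (rule L_VF[OF e_L])

lemma g_frame: "g (e (idx5 m)) (e (idx5 n)) p = (if m = n then 1 else 0)"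
proof -
  have "g (e (idx5 m)) (e (idx5 n)) p = (if idx5 m = idx5 n then 1 else 0)"
    using frame idx5_range[of m] idx5_range[of n] unfolding left_invariant_orthonormal_frame_def by blast
  then show ?thesis by simp
qed

lemma comb_L: "comb k \<in> L"
  unfolding comb_def by (intro subspace_sum[OF L_subspace] subspace_scale[OF L_subspace] e_L)

lemma comb_VF: "comb k \<in> VF"
  using comb_L L_VF by blast

lemma linear_comb: "linear comb"
  by (rule linearI) (simp_all add: comb_def scaleR_add_left sum.distrib scaleR_sum_right)

lemma comb_axis: "comb (axis m 1) = e (idx5 m)"
  by (simp add: comb_def axis_def if_distrib[of "\<lambda>r. r *\<^sub>R _"] cong: if_cong)

lemma g_comb: "g (comb k) (e (idx5 m)) p = k $ m"
proof -
  have "g (comb k) (e (idx5 m)) p = (\<Sum>n\<in>UNIV. k $ n * g (e (idx5 n)) (e (idx5 m)) p)"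
    unfolding comb_def by (subst g_sum) (simp_all add: e_VF scaleR_fun_def sum_fun_apply)
  then show ?thesis by (simp add: g_frame if_distrib[of "(*) _"] cong: if_cong)
qed

lemma comb_eq_0: "comb k = 0 \<Longrightarrow> k = 0"
  using g_comb[of k] g_zero[OF e_VF] by (simp add: vec_eq_iff)

lemma inj_comb: "inj comb"
  using linear_injective_0[OF linear_comb] comb_eq_0 by blast

text \<open>The coefficients of a left-invariant field in the frame are constant: translating the field
  gives a second expansion at the same point, and the left-invariant field of differences vanishes
  there, hence everywhere.\<close>

lemma range_comb: "range comb = L"
proof
  show "range comb \<subseteq> L" using comb_L by blast
  show "L \<subseteq> range comb"
  proof
    fix X assume X: "X \<in> L"
    obtain c where "X = (\<Sum>i\<in>{1..5}. vf_mult (c i) (e i))"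
      using frame L_VF[OF X] unfolding left_invariant_orthonormal_frame_def by blast
    then have Xf: "X f p = (\<Sum>m\<in>UNIV. c (idx5 m) p * e (idx5 m) f p)" for f p
      unfolding sum_idx5 by (simp add: vf_mult_def sum_fun_apply)
    let ?o = "\<one>\<^bsub>G\<^esub>"
    have const: "c (idx5 m) q = c (idx5 m) ?o" for m q
    proof -
      define k where "k = (\<chi> m. c (idx5 m) ?o - c (idx5 m) q)"
      have comb_f: "comb k f p = (\<Sum>m\<in>UNIV. k $ m * e (idx5 m) f p)" for f p
        by (simp add: comb_def sum_fun_apply scaleR_fun_def)
      have at_q: "comb k f q = 0" for f
      proof (cases "f \<in> SF")
        case True
        have q: "q \<otimes>\<^bsub>G\<^esub> ?o = q"
          by (metis UNIV_I carrier group group.is_monoid monoid.r_one)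
        have "X f q = X (\<lambda>x. f (q \<otimes>\<^bsub>G\<^esub> x)) ?o"
          using L_invariant[OF X True] q by simp
        also have "\<dots> = (\<Sum>m\<in>UNIV. c (idx5 m) ?o * e (idx5 m) f q)"
          unfolding Xf using L_invariant[OF e_L True] q by simp
        finally show ?thesis
          unfolding comb_f Xf by (simp add: k_def left_diff_distrib sum_subtractf)
      next
        case False
        then show ?thesis using VF_non_smooth[OF comb_VF] by simp
      qed
      have "comb k f y = 0" for f y
      proof (cases "f \<in> SF")
        case True
        then show ?thesis
          using L_invariant[OF comb_L True, of k "y \<otimes>\<^bsub>G\<^esub> inv\<^bsub>G\<^esub> q" q] at_q
          by (simp add: mult_inv_cancel)
      next
        case False
        then show ?thesis using VF_non_smooth[OF comb_VF] by simp
      qed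
      then have "comb k = 0" by (simp add: fun_eq_iff)
      then have "k $ m = 0" using comb_eq_0 by fastforce
      then show ?thesis by (simp add: k_def)
    qed
    have "X f p = (\<Sum>m\<in>UNIV. c (idx5 m) ?o * e (idx5 m) f p)" for f p
      unfolding Xf by (intro sum.cong refl arg_cong2[of _ _ _ _ "(*)"] const)
    then have "X = comb (\<chi> m. c (idx5 m) ?o)"
      by (simp add: fun_eq_iff comb_def sum_fun_apply scaleR_fun_def)
    then show "X \<in> range comb" by blast
  qed
qed

definition frame_bracket :: "real ^ 5 \<Rightarrow> real ^ 5 \<Rightarrow> real ^ 5" where
  "frame_bracket u v = inv_into UNIV comb (vf_bracket (comb u) (comb v))"

lemma comb_frame_bracket: "comb (frame_bracket u v) = vf_bracket (comb u) (comb v)"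
  unfolding frame_bracket_def using range_comb bracket_L[OF comb_L comb_L] by (simp add: f_inv_into_f)

lemma frame_lie_param: "lie_param frame_bracket L vf_bracket comb"
  by (simp add: lie_param_def linear_comb inj_comb range_comb comb_frame_bracket)

lemma comb_add: "comb (u + v) = comb u + comb v" and comb_scale: "comb (c *\<^sub>R u) = c *\<^sub>R comb u"
  using linear_comb by (simp_all add: linear_add linear_scale)

lemma real5_frame_bracket:
  assumes "nilpotent_lie L vf_bracket"
  shows "real5_bracket frame_bracket"
proof
  \<comment> \<open>Identities for \<open>frame_bracket\<close> are checked after applying the
    injective map \<open>comb\<close>, where they are identities of vector fields.\<close>
  have comb_eq: "u = v" if "comb u = comb v" for u v
    using inj_comb that by (simp add: inj_eq)
  have anti: "frame_bracket u v = - frame_bracket v u" for u v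
    by (rule comb_eq) (simp add: comb_frame_bracket linear_neg[OF linear_comb] bracket_anti[of "comb u"])
  have lin: "linear (\<lambda>u. frame_bracket u v)" for v
  proof (rule linearI)
    show "frame_bracket (u + u') v = frame_bracket u v + frame_bracket u' v" for u u'
      by (rule comb_eq) (simp add: comb_frame_bracket comb_add bracket_add_left comb_VF)
    show "frame_bracket (c *\<^sub>R u) v = c *\<^sub>R frame_bracket u v" for c u
      by (rule comb_eq) (simp add: comb_frame_bracket comb_scale bracket_scale_left comb_VF)
  qed
  show "bilinear frame_bracket"
    unfolding bilinear_def
  proof (intro conjI allI lin)
    fix u show "linear (frame_bracket u)"
      using linear_compose_neg[OF lin[of u]] unfolding anti[of u, symmetric] .
  qed
  show "frame_bracket v v = 0" for v
    by (rule comb_eq) (simp add: comb_frame_bracket vf_bracket_def linear_0[OF linear_comb] fun_eq_iff)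
  show "frame_bracket u (frame_bracket v w) + frame_bracket v (frame_bracket w u) + frame_bracket w (frame_bracket u v) = 0" for u v w
    by (rule comb_eq) (simp add: comb_frame_bracket comb_add bracket_jacobi comb_VF linear_0[OF linear_comb])
  \<comment> \<open>This inclusion carries nilpotency back: once a term for \<open>L\<close> is
    zero, injectivity of \<open>comb\<close> makes the term for \<open>frame_bracket\<close>
    zero.\<close>
  have sub: "comb ` lower_central UNIV frame_bracket k \<subseteq> lower_central L vf_bracket k" for k
  proof (induction k)
    case 0
    then show ?case using range_comb by simp
  next
    case (Suc k)
    have "comb ` span {frame_bracket X Y | X Y. X \<in> UNIV \<and> Y \<in> lower_central UNIV frame_bracket k}
      = span (comb ` {frame_bracket X Y | X Y. X \<in> UNIV \<and> Y \<in> lower_central UNIV frame_bracket k})"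
      by (rule linear_span_image[OF linear_comb, symmetric])
    also have "\<dots> \<subseteq> span {vf_bracket X Y | X Y. X \<in> L \<and> Y \<in> lower_central L vf_bracket k}"
      using Suc.IH comb_L by (intro span_mono) (fastforce simp: comb_frame_bracket)
    finally show ?case by simp
  qed
  obtain k where "lower_central L vf_bracket k = {0}"
    using assms by (auto simp: nilpotent_lie_def)
  then have "lower_central UNIV frame_bracket k \<subseteq> {0}"
    using sub[of k] comb_eq_0 by auto
  moreover have "0 \<in> lower_central UNIV frame_bracket k"
    by (cases k) (auto simp: span_zero)
  ultimately show "nilpotent_lie UNIV frame_bracket"
    unfolding nilpotent_lie_def by blast
qed

text \<open>Taken at the unit element: the structure constants are constant, so the Dirac equation
  at this single point determines the relation between them.\<close>

definition christoffel :: "5 \<Rightarrow> 5 \<Rightarrow> 5 \<Rightarrow> real" where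
  "christoffel m n l = g (con (e (idx5 m)) (e (idx5 n))) (e (idx5 l)) \<one>\<^bsub>G\<^esub>"

lemma con_VF: "X \<in> VF \<Longrightarrow> Y \<in> VF \<Longrightarrow> con X Y \<in> VF"
  using connection by (simp add: levi_civita_def)

text \<open>The products of frame fields are constant functions, so metric compatibility equates a
  zero derivative with the sum of the two symbols.\<close>

lemma christoffel_antisym: "christoffel m n l = - christoffel m l n"
proof -
  have "e (idx5 m) (g (e (idx5 n)) (e (idx5 l)))
      = g (con (e (idx5 m)) (e (idx5 n))) (e (idx5 l)) + g (e (idx5 n)) (con (e (idx5 m)) (e (idx5 l)))"
    using connection e_VF[of m] e_VF[of n] e_VF[of l] unfolding levi_civita_def by blast
  moreover have "g (e (idx5 n)) (e (idx5 l)) = (\<lambda>p. if n = l then 1 else 0)"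
    by (simp add: fun_eq_iff g_frame)
  ultimately have "g (con (e (idx5 m)) (e (idx5 n))) (e (idx5 l)) + g (e (idx5 n)) (con (e (idx5 m)) (e (idx5 l))) = 0"
    using VF_const[OF e_VF] by simp
  then show ?thesis
    using g_sym[OF e_VF con_VF[OF e_VF e_VF]] by (simp add: christoffel_def fun_eq_iff eq_neg_iff_add_eq_0)
qed

lemma frame_bracket_christoffel:
  "frame_bracket (axis m 1) (axis n 1) $ l = christoffel m n l - christoffel n m l"
proof -
  have "frame_bracket (axis m 1) (axis n 1) $ l
      = g (con (e (idx5 m)) (e (idx5 n)) - con (e (idx5 n)) (e (idx5 m))) (e (idx5 l)) \<one>\<^bsub>G\<^esub>"
    using connection e_VF by (simp add: g_comb[symmetric, of _ _ "\<one>\<^bsub>G\<^esub>"] comb_frame_bracket comb_axis levi_civita_def)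
  then show ?thesis
    by (simp add: christoffel_def g_diff con_VF e_VF)
qed

lemma dirac_const_christoffel:
  fixes \<rho> :: "clifford \<Rightarrow> 'w::euclidean_space \<Rightarrow> 'w"
  assumes \<rho>: "clifford_rep 5 \<rho>" and dirac: "dirac 5 \<rho> g con e (\<lambda>x. w) = 0"
  shows "(\<Sum>m\<in>UNIV. \<Sum>n\<in>UNIV. \<Sum>l\<in>UNIV.
    christoffel m n l *\<^sub>R \<rho> (blade {idx5 m}) (\<rho> (blade {idx5 n}) (\<rho> (blade {idx5 l}) w))) = 0"
proof -
  let ?R = "\<lambda>m. \<rho> (blade {idx5 m})"
  have "linear (?R m)" for m
    using clifford_rep_linear[OF \<rho> idx5_range] .
  note lin = linear_sum[OF this] linear_scale[OF this]
  \<comment> \<open>The factor 4 is 2 * 2: one 2 cancels the one half in the spin connection, the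
    other turns the sum over j < k into the full double sum.\<close>
  have "4 *\<^sub>R spin_connection 5 \<rho> g con e (e (idx5 m)) (\<lambda>x. w) \<one>\<^bsub>G\<^esub>
      = (\<Sum>n\<in>UNIV. \<Sum>l\<in>UNIV. christoffel m n l *\<^sub>R ?R n (?R l w))" for m
  proof -
    have "vf_apply (e (idx5 m)) (\<lambda>x. w) \<one>\<^bsub>G\<^esub> = 0"
      by (simp add: vf_apply_def VF_const[OF e_VF])
    then have "4 *\<^sub>R spin_connection 5 \<rho> g con e (e (idx5 m)) (\<lambda>x. w) \<one>\<^bsub>G\<^esub>
      = 2 *\<^sub>R (\<Sum>j\<in>{1..5}. \<Sum>k\<in>{j<..5}. g (con (e (idx5 m)) (e j)) (e k) \<one>\<^bsub>G\<^esub> *\<^sub>R \<rho> (blade {j}) (\<rho> (blade {k}) w))"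
      by (simp add: spin_connection_def)
    also have "\<dots> = (\<Sum>n\<in>UNIV. \<Sum>l\<in>UNIV. g (con (e (idx5 m)) (e (idx5 n))) (e (idx5 l)) \<one>\<^bsub>G\<^esub> *\<^sub>R ?R n (?R l w))"
    proof (rule sum_less_idx5)
      fix j k :: nat assume jk: "j \<in> {1..5}" "k \<in> {1..5}"
      have idx: "\<exists>n. j = idx5 n" if "j \<in> {1..5}" for j
        using that idx5_simps unfolding atLeastAtMost_1_5 by (metis empty_iff insert_iff)
      then obtain n l where nl: "j = idx5 n" "k = idx5 l" using jk by blast
      show "g (con (e (idx5 m)) (e k)) (e j) \<one>\<^bsub>G\<^esub> *\<^sub>R \<rho> (blade {k}) (\<rho> (blade {j}) w)
          = g (con (e (idx5 m)) (e j)) (e k) \<one>\<^bsub>G\<^esub> *\<^sub>R \<rho> (blade {j}) (\<rho> (blade {k}) w)"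
      proof (cases "j = k")
        \<comment> \<open>Christoffel symbol and Clifford product both change sign when j and k are
          exchanged.\<close>
        case False
        then have "\<rho> (blade {k}) (\<rho> (blade {j}) w) = - \<rho> (blade {j}) (\<rho> (blade {k}) w)"
          using clifford_rep_anticommute[OF \<rho> jk, of w] by (simp add: eq_neg_iff_add_eq_0 add.commute)
        moreover have "g (con (e (idx5 m)) (e k)) (e j) \<one>\<^bsub>G\<^esub> = - g (con (e (idx5 m)) (e j)) (e k) \<one>\<^bsub>G\<^esub>"
          using christoffel_antisym[of m l n] nl by (simp add: christoffel_def)
        ultimately show ?thesis by simp
      qed simp
    next
      fix j :: nat assume "j \<in> {1..5}"
      then obtain n where "j = idx5 n"
        using idx5_simps unfolding atLeastAtMost_1_5 by (metis empty_iff insert_iff)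
      then show "g (con (e (idx5 m)) (e j)) (e j) \<one>\<^bsub>G\<^esub> *\<^sub>R \<rho> (blade {j}) (\<rho> (blade {j}) w) = 0"
        using christoffel_antisym[of m n n] by (simp add: christoffel_def)
    qed
    finally show ?thesis by (simp add: christoffel_def)
  qed
  note spin = this
  have "(\<Sum>m\<in>UNIV. ?R m (4 *\<^sub>R spin_connection 5 \<rho> g con e (e (idx5 m)) (\<lambda>x. w) \<one>\<^bsub>G\<^esub>))
      = 4 *\<^sub>R dirac 5 \<rho> g con e (\<lambda>x. w) \<one>\<^bsub>G\<^esub>"
    unfolding dirac_def sum_idx5 by (simp add: lin scaleR_sum_right)
  then show ?thesis
    unfolding spin using dirac by (simp add: lin)
qed

lemma harmonic_spinor_lie_algebra:
  fixes \<rho> :: "clifford \<Rightarrow> 'w::euclidean_space \<Rightarrow> 'w"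
  assumes nil: "nilpotent_lie L vf_bracket" and nab: "\<not> abelian_lie L vf_bracket"
    and \<rho>: "clifford_rep 5 \<rho>" and "w \<noteq> 0" and dirac: "dirac 5 \<rho> g con e (\<lambda>x. w) = 0"
  shows "\<exists>m\<in>{L51, L52, L53, L54, L56}. lie_isomorphic L vf_bracket UNIV m"
proof -
  interpret real5_bracket frame_bracket
    using real5_frame_bracket[OF nil] .
  have "\<exists>u v. frame_bracket u v \<noteq> 0"
  proof (rule ccontr)
    assume "\<not> ?thesis"
    then have "vf_bracket (comb u) (comb v) = 0" for u v
      using comb_frame_bracket[of u v] linear_0[OF linear_comb] by simp
    then show False
      using nab unfolding abelian_lie_def range_comb[symmetric] by blast
  qed
  moreover have "(\<Sum>m\<in>UNIV. \<Sum>n\<in>UNIV. \<Sum>l\<in>UNIV. frame_bracket (axis m 1) (axis n 1) $ l *\<^sub>R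
      \<rho> (blade {idx5 m}) (\<rho> (blade {idx5 n}) (\<rho> (blade {idx5 l}) w))) = 0"
  proof (rule dirac_christoffel_to_structure[OF _ _ christoffel_antisym frame_bracket_christoffel _ dirac_const_christoffel[OF \<rho> dirac]])
    show "linear (\<rho> (blade {idx5 m}))" for m
      using clifford_rep_linear[OF \<rho> idx5_range] .
    show "\<rho> (blade {idx5 m}) (\<rho> (blade {idx5 n}) w) + \<rho> (blade {idx5 n}) (\<rho> (blade {idx5 m}) w)
        = (if m = n then - 2 else 0) *\<^sub>R w" for m n w
      using clifford_rep_anticommute[OF \<rho> idx5_range idx5_range, of m n w] by simp
    show "(\<Sum>m\<in>UNIV. frame_bracket (axis l 1) (axis m 1) $ m) = 0" for l
      using trace_ad_eq_0[of "axis l 1"] by (simp add: inner_axis)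
  qed
  \<comment> \<open>The sum over \<open>l\<close> is gathered into Clifford multiplication by the
    bracket vector, a form independent of the orthonormal basis.\<close>
  then have "(\<Sum>m\<in>UNIV. \<Sum>n\<in>UNIV. clifford_vec \<rho> (axis m 1) (clifford_vec \<rho> (axis n 1)
      (clifford_vec \<rho> (frame_bracket (axis m 1) (axis n 1)) w))) = 0"
    unfolding clifford_vec_axis
    by (simp add: clifford_vec_def linear_sum[OF clifford_rep_linear[OF \<rho> idx5_range]]
      linear_scale[OF clifford_rep_linear[OF \<rho> idx5_range]])
  ultimately have "\<exists>m\<in>{L51, L52, L53, L54, L56}. \<exists>F. lie_param m UNIV frame_bracket F"
    by (intro harmonic_spinor_classification[OF _ bilinear_clifford_vec[OF \<rho>] clifford_vec_clifford[OF \<rho>] _ \<open>w \<noteq> 0\<close>])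
  then show ?thesis
    using lie_param_trans[OF _ frame_lie_param] lie_param_imp_isomorphic by blast
qed

end

theorem theorem6p5:
  fixes \<A> :: "('g::{t2_space, second_countable_topology}, 5) atlas"
    and G :: "'g monoid"
    and \<Gamma> :: "'g set"
    and \<rho> :: "clifford \<Rightarrow> 'w::euclidean_space \<Rightarrow> 'w"
  assumes "nilpotent_lie_group \<A> G"
    and "connected (UNIV :: 'g set)"
    and "simply_connected (UNIV :: 'g set)"
    and "\<not> abelian_lie_group \<A> G"
    and "subgroup \<Gamma> G"
    and "discrete \<Gamma>"
    and "irreducible_clifford_rep 5 \<rho>"
    and "\<exists>g con e \<phi>.
           left_invariant_metric \<A> G g \<and>
           levi_civita \<A> g con \<and>
           left_invariant_orthonormal_frame \<A> G g 5 e \<and>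
           \<phi> \<in> spinors \<A> G \<Gamma> \<and>
           \<phi> constant_on UNIV \<and>
           \<phi> \<noteq> 0 \<and>
           dirac 5 \<rho> g con e \<phi> = 0"
  shows "lie_isomorphic (lie_algebra_of \<A> G) vf_bracket UNIV L51 \<or>
         lie_isomorphic (lie_algebra_of \<A> G) vf_bracket UNIV L52 \<or>
         lie_isomorphic (lie_algebra_of \<A> G) vf_bracket UNIV L53 \<or>
         lie_isomorphic (lie_algebra_of \<A> G) vf_bracket UNIV L54 \<or>
         lie_isomorphic (lie_algebra_of \<A> G) vf_bracket UNIV L56"
proof -
  obtain g con e \<phi> where *: "left_invariant_metric \<A> G g" "levi_civita \<A> g con"
    "left_invariant_orthonormal_frame \<A> G g 5 e" "\<phi> constant_on UNIV" "\<phi> \<noteq> 0" "dirac 5 \<rho> g con e \<phi> = 0"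
    using assms(8) by blast
  then obtain w where \<phi>: "\<phi> = (\<lambda>x. w)"
    by (auto simp: constant_on_def fun_eq_iff)
  with \<open>\<phi> \<noteq> 0\<close> have "w \<noteq> 0"
    by (auto simp: fun_eq_iff)
  interpret lie_frame \<A> G g con e
    using * assms(1) by unfold_locales (simp_all add: nilpotent_lie_group_def left_invariant_metric_def)
  have "\<exists>m\<in>{L51, L52, L53, L54, L56}. lie_isomorphic L vf_bracket UNIV m"
    using assms(1,4,7) *(6) \<open>w \<noteq> 0\<close> unfolding \<phi>
    by (intro harmonic_spinor_lie_algebra[of \<rho> w])
      (simp_all add: nilpotent_lie_group_def abelian_lie_group_def irreducible_clifford_rep_def)
  then show ?thesis by blast
qed

end
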